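(* Let $k\ge 1$ be an integer, let $p>1+\frac1k$, and let $\{T_m\}_{m\ge 0}$ be the $\mathsf{GN}$ process with attachment kernel $f(x)=(x+1)^p$. Let $T_\infty=\bigcup_{m\ge 0}T_m$ be the increasing limit of the process. Then with probability $1$ all but finitely many nodes of $T_\infty$ have fewer than $k$ descendants in $T_\infty$.
   Context: All trees are rooted with edges directed towards the root. If $(a,b)$ is an oriented edge, $a$ is a child of $b$. The (in-)degree $\mathrm d_T(b)$ of a node $b$ in a tree $T$ is the number of its children. The descendants of $r$ are its children, the children of those children, and so on ($r$ itself excluded). The $\mathsf{GN}$ process with attachment kernel $f:\mathbb N\cup\{0\}\to(0,\infty)$ is the following Markov chain of random finite trees $T_m=(V_m,E_m)$, $m=0,1,2,\dots$. $T_0$ consists of a single root node and no edges. At each time $m\ge 1$, a new node $v_m$ is added together with a single new edge from $v_m$ to $w_m\in V_{m-1}$ (so $v_m$ becomes a child of $w_m$), where $$\mathbb P(w_m=w\mid T_{m-1})=\frac{f(\mathrm d_{T_{m-1}}(w))}{\sum_{v\in V_{m-1}}f(\mathrm d_{T_{m-1}}(v))}\qquad (w\in V_{m-1}).$$ $T_\infty$ is the infinite rooted tree with node set $\bigcup_m V_m$ and edge set $\bigcup_m E_m$. *)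

theory Defs
  imports "HOL-Probability.Probability" "Graph_Theory.Pair_Digraph"
begin

text \<open>An edge \<open>(a, b)\<close> is directed from the child \<open>a\<close> to its parent \<open>b\<close>, so the number of children
  of \<open>b\<close> is the library's \<^const>\<open>in_degree\<close>, and the descendants of \<open>r\<close> are the nodes from which
  \<open>r\<close> is reached by a nonempty directed path.\<close>

definition descendants :: "'a pair_pre_digraph \<Rightarrow> 'a \<Rightarrow> 'a set" where
  "descendants T r = {u. u \<rightarrow>\<^sup>+\<^bsub>T\<^esub> r}"

definition add_child :: "'a pair_pre_digraph \<Rightarrow> 'a \<Rightarrow> 'a \<Rightarrow> 'a pair_pre_digraph" where
  "add_child T v w = \<lparr>pverts = insert v (pverts T), parcs = insert (v, w) (parcs T)\<rparr>"

text \<open>The node added at time \<open>m\<close> is named \<open>m\<close>, and the root is named \<open>0\<close>. With these names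
  \<open>T m\<close> determines \<open>T 0, \<dots>, T (m - 1)\<close>, so conditioning on the current tree is the same as
  conditioning on the whole past. The value \<open>w 0\<close> plays no role.\<close>

locale GN_process = prob_space M
  for M :: "'a measure" +
  fixes f :: "nat \<Rightarrow> real"
    and w :: "nat \<Rightarrow> 'a \<Rightarrow> nat"
    and T :: "nat \<Rightarrow> 'a \<Rightarrow> nat pair_pre_digraph"
  assumes kernel_pos: "\<And>x. f x > 0"
    and rv_w: "\<And>m. w (Suc m) \<in> M \<rightarrow>\<^sub>M count_space UNIV"
    and w_in: "\<And>m \<omega>. \<omega> \<in> space M \<Longrightarrow> w (Suc m) \<omega> \<in> pverts (T m \<omega>)"
    and T_0: "\<And>\<omega>. \<omega> \<in> space M \<Longrightarrow> T 0 \<omega> = \<lparr>pverts = {0}, parcs = {}\<rparr>"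
    and T_Suc: "\<And>m \<omega>. \<omega> \<in> space M \<Longrightarrow>
        T (Suc m) \<omega> = add_child (T m \<omega>) (Suc m) (w (Suc m) \<omega>)"
    and attachment: "\<And>m t x. \<P>(\<omega> in M. T m \<omega> = t) > 0 \<Longrightarrow> x \<in> pverts t \<Longrightarrow>
        \<P>(\<omega> in M. w (Suc m) \<omega> = x \<bar> T m \<omega> = t) =
          f (in_degree t x) / (\<Sum>v\<in>pverts t. f (in_degree t v))"

definition limit_tree :: "(nat \<Rightarrow> 'a pair_pre_digraph) \<Rightarrow> 'a pair_pre_digraph" where
  "limit_tree T = \<lparr>pverts = (\<Union>m. pverts (T m)), parcs = (\<Union>m. parcs (T m))\<rparr>"

end

theory Submission
  imports Defs
begin

text \<open>Let \<open>Z\<^sub>m\<close> be the total weight and \<open>D\<^sub>m\<close> the maximal degree at time \<open>m\<close>. A node of maximal degree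
  receives the next edge with probability \<open>(D\<^sub>m + 1)\<^sup>p / Z\<^sub>m\<close>, so \<open>(D\<^sub>m + 1)\<^sup>1\<^sup>-\<^sup>p\<close> decreases in conditional mean
  by at least \<open>\<kappa> / Z\<^sub>m\<close> for a constant \<open>\<kappa> > 0\<close>. Since \<open>Z\<^sub>m \<le> (2 m + 1) (D\<^sub>m + 1)\<^sup>p\<^sup>-\<^sup>1\<close>, half of this decrease
  already makes \<open>(m + 1)\<^sup>\<delta> (D\<^sub>m + 1)\<^sup>1\<^sup>-\<^sup>p\<close> a supermartingale for \<open>\<delta> = \<kappa> / 4\<close>; the other half then shows that
  \<open>\<Sum>m. (m + 1)\<^sup>\<delta> / Z\<^sub>m\<close> has finite expectation. As \<open>Z\<^sub>m\<close> is increasing, almost surely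
  \<open>Z\<^sub>m \<ge> c (m + 1)\<^sup>1\<^sup>+\<^sup>\<delta>\<close> for some random \<open>c > 0\<close>.

  While \<open>Z\<^sub>m \<ge> c (m + 1)\<^sup>q\<close>, a subtree with at most \<open>k\<close> nodes gains a node at time \<open>m + 1\<close> with probability
  \<open>O(m\<^sup>-\<^sup>q)\<close>, so the node \<open>r\<close> ever has \<open>k\<close> descendants with probability \<open>O(r\<^sup>-\<^sup>k\<^sup>(\<^sup>q\<^sup>-\<^sup>1\<^sup>))\<close>, which is summable if
  \<open>k (q - 1) > 1\<close>. With \<open>q = 1 + \<delta>\<close> and a large constant \<open>K\<close> in place of \<open>k\<close>, only finitely many nodes ever
  have degree \<open>\<ge> K\<close>. The nodes of degree \<open>< K\<close> have total weight \<open>O(m)\<close> and therefore receive at most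
  \<open>m / 2 + O(1)\<close> of the edges, so one of the finitely many others has linear degree and \<open>Z\<^sub>m \<ge> c (m + 1)\<^sup>p\<close>. Now the
  same argument applies with \<open>q = p\<close> and the given \<open>k\<close>.\<close>

section \<open>The process as a random parent function\<close>

definition parent_map :: "(nat \<Rightarrow> nat) \<Rightarrow> bool" where
  "parent_map h \<longleftrightarrow> (\<forall>j\<ge>1. h j < j)"

definition indeg :: "(nat \<Rightarrow> nat) \<Rightarrow> nat \<Rightarrow> nat \<Rightarrow> nat" where
  "indeg h m v = card {j \<in> {1..m}. h j = v}"

definition weight :: "(nat \<Rightarrow> real) \<Rightarrow> (nat \<Rightarrow> nat) \<Rightarrow> nat \<Rightarrow> real" where
  "weight f h m = (\<Sum>v\<le>m. f (indeg h m v))"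

definition tree_of :: "(nat \<Rightarrow> nat) \<Rightarrow> nat \<Rightarrow> nat pair_pre_digraph" where
  "tree_of h m = \<lparr>pverts = {..m}, parcs = (\<lambda>j. (j, h j)) ` {1..m}\<rparr>"

text \<open>Descendants at time \<open>m\<close> are determined by the first \<open>m\<close> parents only if parents precede
  their children, so just the functions with this property are compared.\<close>

definition depends_upto :: "nat \<Rightarrow> ((nat \<Rightarrow> nat) \<Rightarrow> 'b) \<Rightarrow> bool" where
  "depends_upto m \<phi> \<longleftrightarrow>
     (\<forall>h h'. parent_map h \<longrightarrow> parent_map h' \<longrightarrow> (\<forall>j\<in>{1..m}. h j = h' j) \<longrightarrow> \<phi> h = \<phi> h')"

text \<open>Canonical representative of the history up to time \<open>m\<close>. The default 0 keeps
  it a parent map and also overwrites the value at 0, so that \<open>cuts m\<close> is a finite set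
  of histories.\<close>

definition cut :: "nat \<Rightarrow> (nat \<Rightarrow> nat) \<Rightarrow> nat \<Rightarrow> nat" where
  "cut m h = (\<lambda>j. if j \<in> {1..m} then h j else 0)"

definition cuts :: "nat \<Rightarrow> (nat \<Rightarrow> nat) set" where
  "cuts m = cut m ` {h. parent_map h}"

section \<open>Functionals of the first \<open>m\<close> parents\<close>

lemma depends_uptoD:
  "depends_upto m \<phi> \<Longrightarrow> parent_map h \<Longrightarrow> parent_map h' \<Longrightarrow>
     (\<And>j. 1 \<le> j \<Longrightarrow> j \<le> m \<Longrightarrow> h j = h' j) \<Longrightarrow> \<phi> h = \<phi> h'"
  unfolding depends_upto_def Ball_def atLeastAtMost_iff by blast

lemma depends_uptoI:
  "(\<And>h h'. parent_map h \<Longrightarrow> parent_map h' \<Longrightarrow> (\<And>j. 1 \<le> j \<Longrightarrow> j \<le> m \<Longrightarrow> h j = h' j) \<Longrightarrow> \<phi> h = \<phi> h')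
     \<Longrightarrow> depends_upto m \<phi>"
  unfolding depends_upto_def Ball_def atLeastAtMost_iff by blast

lemma depends_upto_compose: "depends_upto m \<phi> \<Longrightarrow> depends_upto m (\<lambda>h. g (\<phi> h))"
  unfolding depends_upto_def by (intro allI impI arg_cong[where f = g]) blast

lemma depends_upto_compose2:
  "depends_upto m \<phi> \<Longrightarrow> depends_upto m \<psi> \<Longrightarrow> depends_upto m (\<lambda>h. g (\<phi> h) (\<psi> h))"
  unfolding depends_upto_def by (intro allI impI arg_cong2[where f = g]) blast+

lemma depends_upto_mono: "depends_upto m \<phi> \<Longrightarrow> m \<le> n \<Longrightarrow> depends_upto n \<phi>"
  by (rule depends_uptoI, erule depends_uptoD) auto

lemma indeg_cong: "(\<And>j. 1 \<le> j \<Longrightarrow> j \<le> m \<Longrightarrow> h j = h' j) \<Longrightarrow> indeg h m v = indeg h' m v"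
  unfolding indeg_def by (rule arg_cong[where f = card]) auto

lemma depends_upto_indeg: "depends_upto m (\<lambda>h. indeg h m)"
  by (intro depends_uptoI ext indeg_cong) auto

lemma weight_cong: "(\<And>j. 1 \<le> j \<Longrightarrow> j \<le> m \<Longrightarrow> h j = h' j) \<Longrightarrow> weight f h m = weight f h' m"
  unfolding weight_def using indeg_cong[of m h h'] by auto

lemma depends_upto_weight: "depends_upto m (\<lambda>h. weight f h m)"
  by (intro depends_uptoI weight_cong) auto

lemma weight_pos: "(\<And>x. f x > 0) \<Longrightarrow> weight f h m > 0"
  unfolding weight_def by (intro sum_pos) auto

lemma parent_map_cut: "parent_map h \<Longrightarrow> parent_map (cut m h)"
  by (auto simp: parent_map_def cut_def)

lemma depends_upto_cut: "depends_upto m \<phi> \<Longrightarrow> parent_map h \<Longrightarrow> \<phi> (cut m h) = \<phi> h"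
  by (erule depends_uptoD[OF _ parent_map_cut]) (simp_all add: cut_def)

lemma cut_eq_iff:
  assumes "h \<in> cuts m"
  shows "cut m h' = h \<longleftrightarrow> (\<forall>j\<in>{1..m}. h' j = h j)"
proof -
  have "j \<notin> {1..m} \<Longrightarrow> h j = 0" for j
    using assms by (auto simp: cuts_def cut_def)
  then show ?thesis
    unfolding cut_def fun_eq_iff by (metis (full_types))
qed

lemma finite_cuts: "finite (cuts m)"
proof (rule finite_subset)
  show "cuts m \<subseteq> {h. \<forall>j. (j \<in> {1..m} \<longrightarrow> h j \<in> {..m}) \<and> (j \<notin> {1..m} \<longrightarrow> h j = 0)}"
    unfolding cuts_def cut_def parent_map_def
    by (auto simp: Suc_le_eq) (meson less_imp_le less_le_trans)
  show "finite {h. \<forall>j. (j \<in> {1..m} \<longrightarrow> h j \<in> {..m}) \<and> (j \<notin> {1..m} \<longrightarrow> h j = (0::nat))}"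
    by (rule finite_set_of_finite_funs) auto
qed

lemma in_degree_tree_of: "in_degree (tree_of h m) v = indeg h m v"
proof -
  have "in_arcs (with_proj (tree_of h m)) v = (\<lambda>j. (j, h j)) ` {j \<in> {1..m}. h j = v}"
    by (auto simp: in_arcs_def tree_of_def)
  then show ?thesis
    by (simp add: in_degree_def indeg_def card_image inj_on_def)
qed

lemma pverts_tree_of: "pverts (tree_of h m) = {..m}"
  by (simp add: tree_of_def)

text \<open>Every node other than the root has exactly one outgoing arc, so the arcs recover the
  parents. Conditioning on the tree is thereby conditioning on \<open>cut m\<close>.\<close>

lemma tree_of_eq_iff: "tree_of h m = tree_of h' m \<longleftrightarrow> (\<forall>j\<in>{1..m}. h j = h' j)"
proof
  assume "tree_of h m = tree_of h' m"
  then have eq: "(\<lambda>j. (j, h j)) ` {1..m} = (\<lambda>j. (j, h' j)) ` {1..m}"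
    by (simp add: tree_of_def)
  show "\<forall>j\<in>{1..m}. h j = h' j"
  proof
    fix j assume "j \<in> {1..m}"
    then have "(j, h j) \<in> (\<lambda>j. (j, h' j)) ` {1..m}" unfolding eq[symmetric] by auto
    then show "h j = h' j" by auto
  qed
qed (auto simp: tree_of_def)

text \<open>By monotone convergence the sum of the series has integral at most \<open>C\<close>,
  hence it is finite almost everywhere.\<close>

lemma (in prob_space) AE_summable_of_bounded_expectation:
  fixes g :: "nat \<Rightarrow> 'a \<Rightarrow> real"
  assumes int: "\<And>j. integrable M (g j)"
    and nonneg: "\<And>j \<omega>. \<omega> \<in> space M \<Longrightarrow> 0 \<le> g j \<omega>"
    and bound: "\<And>n. (\<Sum>j<n. expectation (g j)) \<le> C"
  shows "AE \<omega> in M. summable (\<lambda>j. g j \<omega>)"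
proof -
  have "(\<integral>\<^sup>+\<omega>. (\<Sum>j. ennreal (g j \<omega>)) \<partial>M) = (\<Sum>j. \<integral>\<^sup>+\<omega>. ennreal (g j \<omega>) \<partial>M)"
    using borel_measurable_integrable[OF int] by (intro nn_integral_suminf) measurable
  also have "\<dots> = (\<Sum>j. ennreal (expectation (g j)))"
    using nonneg by (intro suminf_cong nn_integral_eq_integral int) auto
  also have "\<dots> \<le> ennreal C"
  proof (rule suminf_le_const)
    fix n
    have "(\<Sum>j<n. ennreal (expectation (g j))) = ennreal (\<Sum>j<n. expectation (g j))"
      using nonneg by (intro sum_ennreal Bochner_Integration.integral_nonneg)
    then show "(\<Sum>j<n. ennreal (expectation (g j))) \<le> ennreal C"
      using bound[of n] by (simp add: ennreal_leI)
  qed (rule summableI)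
  finally have "(\<integral>\<^sup>+\<omega>. (\<Sum>j. ennreal (g j \<omega>)) \<partial>M) \<noteq> \<infinity>"
    by (auto simp: top_unique)
  then have "AE \<omega> in M. (\<Sum>j. ennreal (g j \<omega>)) \<noteq> \<infinity>"
    using borel_measurable_integrable[OF int] by (intro nn_integral_PInf_AE) measurable
  then show ?thesis
    using AE_space by eventually_elim (auto intro!: summable_suminf_not_top nonneg)
qed

section \<open>Measurability and the one-step transition of the process\<close>

context GN_process
begin

abbreviation parents :: "'a \<Rightarrow> nat \<Rightarrow> nat" where
  "parents \<omega> \<equiv> \<lambda>j. w j \<omega>"

lemma T_eq_tree_of: "\<omega> \<in> space M \<Longrightarrow> T m \<omega> = tree_of (parents \<omega>) m"
proof (induction m)
  case (Suc m)
  have "{1..Suc m} = insert (Suc m) {1..m}" "{..Suc m} = insert (Suc m) {..m}" by auto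
  then show ?case using Suc T_Suc[of \<omega> m] by (simp add: tree_of_def add_child_def)
qed (auto simp: T_0 tree_of_def)

lemma parent_map_parents: "\<omega> \<in> space M \<Longrightarrow> parent_map (parents \<omega>)"
  unfolding parent_map_def
proof (intro allI impI)
  fix j :: nat assume \<omega>: "\<omega> \<in> space M" and "1 \<le> j"
  then obtain m where "j = Suc m" by (cases j) auto
  then show "w j \<omega> < j" using w_in[OF \<omega>, of m] T_eq_tree_of[OF \<omega>, of m] by (simp add: tree_of_def)
qed

lemma parents_measurable: "j \<ge> 1 \<Longrightarrow> w j \<in> M \<rightarrow>\<^sub>M count_space UNIV"
  using rv_w[of "j - 1"] by simp

text \<open>There are finitely many values, and each fibre is a finite intersection of events
  \<open>w j \<omega> = h j\<close>.\<close>

lemma cut_parents_measurable: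
  "(\<lambda>\<omega>. cut m (parents \<omega>)) \<in> M \<rightarrow>\<^sub>M count_space (cuts m)"
  unfolding measurable_count_space_eq2[OF finite_cuts]
proof (intro conjI ballI)
  show "(\<lambda>\<omega>. cut m (parents \<omega>)) \<in> space M \<rightarrow> cuts m"
    using parent_map_parents by (auto simp: cuts_def)
  fix h assume h: "h \<in> cuts m"
  have "(\<lambda>\<omega>. cut m (parents \<omega>)) -` {h} \<inter> space M = {\<omega> \<in> space M. \<forall>j\<in>{1..m}. w j \<omega> = h j}"
    by (simp add: set_eq_iff cut_eq_iff[OF h] conj_commute)
  also have "\<dots> \<in> sets M"
  proof (intro sets.sets_Collect_finite_All)
    fix j assume "j \<in> {1..m}"
    then have [measurable]: "w j \<in> M \<rightarrow>\<^sub>M count_space UNIV" by (intro parents_measurable) simp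
    show "{\<omega> \<in> space M. w j \<omega> = h j} \<in> sets M" by measurable
  qed auto
  finally show "(\<lambda>\<omega>. cut m (parents \<omega>)) -` {h} \<inter> space M \<in> sets M" .
qed

text \<open>On the sample space \<open>\<phi>\<close> factors through the finite-valued map
  \<open>cut m\<close>, and every function on a count space is measurable.\<close>

lemma depends_upto_measurable:
  assumes "depends_upto m \<phi>" "\<And>x. \<phi> x \<in> space N"
  shows "(\<lambda>\<omega>. \<phi> (parents \<omega>)) \<in> M \<rightarrow>\<^sub>M N"
proof -
  have "(\<lambda>\<omega>. \<phi> (cut m (parents \<omega>))) \<in> M \<rightarrow>\<^sub>M N"
    by (rule measurable_compose[OF cut_parents_measurable]) (use assms in auto)
  also have "?this \<longleftrightarrow> ?thesis"
    by (intro measurable_cong depends_upto_cut assms parent_map_parents)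
  finally show ?thesis .
qed

lemma depends_upto_integrable:
  fixes \<phi> :: "(nat \<Rightarrow> nat) \<Rightarrow> real"
  assumes "depends_upto m \<phi>"
  shows "integrable M (\<lambda>\<omega>. \<phi> (parents \<omega>))"
proof (rule integrable_const_bound)
  show "AE \<omega> in M. norm (\<phi> (parents \<omega>)) \<le> (\<Sum>h\<in>cuts m. \<bar>\<phi> h\<bar>)"
  proof (rule AE_I2)
    fix \<omega> assume "\<omega> \<in> space M"
    then have pm: "parent_map (parents \<omega>)" by (rule parent_map_parents)
    have "\<bar>\<phi> (cut m (parents \<omega>))\<bar> \<le> (\<Sum>h\<in>cuts m. \<bar>\<phi> h\<bar>)"
      using pm by (intro member_le_sum finite_cuts) (auto simp: cuts_def)
    then show "norm (\<phi> (parents \<omega>)) \<le> (\<Sum>h\<in>cuts m. \<bar>\<phi> h\<bar>)"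
      using depends_upto_cut[OF assms pm] by simp
  qed
  show "(\<lambda>\<omega>. \<phi> (parents \<omega>)) \<in> borel_measurable M"
    by (rule depends_upto_measurable[OF assms]) simp
qed

lemma depends_upto_sets:
  "depends_upto m P \<Longrightarrow> {\<omega> \<in> space M. P (parents \<omega>)} \<in> sets M"
  using depends_upto_measurable[of m P "count_space UNIV"] by simp

text \<open>Product form of \<open>attachment\<close>, with the tree replaced by the history that it
  encodes. It also covers histories of probability zero, for which both sides vanish.\<close>

lemma prob_next_parent:
  assumes h: "h \<in> cuts m" and x: "x \<le> m"
  shows "prob {\<omega> \<in> space M. cut m (parents \<omega>) = h \<and> w (Suc m) \<omega> = x} =
         prob {\<omega> \<in> space M. cut m (parents \<omega>) = h} * (f (indeg h m x) / weight f h m)"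
proof -
  note tr = cut_eq_iff[OF h]
  have T: "T m \<omega> = tree_of h m \<longleftrightarrow> cut m (parents \<omega>) = h" if "\<omega> \<in> space M" for \<omega>
    using that by (simp add: T_eq_tree_of tree_of_eq_iff tr)
  have meas: "{\<omega> \<in> space M. cut m (parents \<omega>) = h} \<in> sets M"
    by (rule depends_upto_sets[of m "\<lambda>h'. cut m h' = h"])
       (auto simp: depends_upto_def tr)
  have eq1: "{\<omega> \<in> space M. T m \<omega> = tree_of h m} = {\<omega> \<in> space M. cut m (parents \<omega>) = h}"
    using T by auto
  have eq2: "{\<omega> \<in> space M. w (Suc m) \<omega> = x \<and> T m \<omega> = tree_of h m} =
      {\<omega> \<in> space M. cut m (parents \<omega>) = h \<and> w (Suc m) \<omega> = x}"
    using T by auto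
  show ?thesis
  proof (cases "prob {\<omega> \<in> space M. cut m (parents \<omega>) = h} > 0")
    case True
    have "\<P>(\<omega> in M. w (Suc m) \<omega> = x \<bar> T m \<omega> = tree_of h m) = f (indeg h m x) / weight f h m"
      using attachment[of m "tree_of h m" x, unfolded in_degree_tree_of eq1] True x
      by (simp add: weight_def pverts_tree_of)
    moreover have "a / b = c \<Longrightarrow> b > 0 \<Longrightarrow> a = b * c" for a b c :: real
      by (simp add: field_simps)
    ultimately show ?thesis
      using True unfolding cond_prob_def eq1 eq2 by blast
  next
    case False
    then have 0: "prob {\<omega> \<in> space M. cut m (parents \<omega>) = h} = 0"
      using measure_nonneg[of M "{\<omega> \<in> space M. cut m (parents \<omega>) = h}"] by linarith
    have "prob {\<omega> \<in> space M. cut m (parents \<omega>) = h \<and> w (Suc m) \<omega> = x} \<le>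
          prob {\<omega> \<in> space M. cut m (parents \<omega>) = h}"
      by (intro finite_measure_mono meas) blast
    with 0 have "prob {\<omega> \<in> space M. cut m (parents \<omega>) = h \<and> w (Suc m) \<omega> = x} = 0"
      by (simp only: measure_le_0_iff)
    then show ?thesis unfolding 0 by (simp only: mult_zero_left)
  qed
qed

text \<open>The tower property written out by hand: since the past takes finitely many values, the
  expectation is a finite sum over pairs of a history and a next parent, to which
  \<open>prob_next_parent\<close> applies.\<close>

lemma expectation_step:
  fixes \<phi> :: "(nat \<Rightarrow> nat) \<Rightarrow> nat \<Rightarrow> real"
  assumes \<phi>: "depends_upto m \<phi>"
  shows "expectation (\<lambda>\<omega>. \<phi> (parents \<omega>) (w (Suc m) \<omega>)) =
    expectation (\<lambda>\<omega>. (\<Sum>x\<le>m. f (indeg (parents \<omega>) m x) * \<phi> (parents \<omega>) x) / weight f (parents \<omega>) m)"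
proof -
  let ?S = "cuts m"
  let ?H = "\<lambda>\<omega>. cut m (parents \<omega>)"
  have H: "?H \<omega> \<in> ?S" if "\<omega> \<in> space M" for \<omega>
    using parent_map_parents[OF that] by (auto simp: cuts_def)
  have [measurable]: "{\<omega> \<in> space M. ?H \<omega> = h} \<in> sets M" for h
    by (rule depends_upto_sets[of m "\<lambda>h'. cut m h' = h"])
       (auto simp: depends_upto_def cut_def)
  have wm [measurable]: "w (Suc m) \<in> M \<rightarrow>\<^sub>M count_space UNIV" by (rule rv_w)
  have [measurable]: "{\<omega> \<in> space M. ?H \<omega> = h \<and> w (Suc m) \<omega> = x} \<in> sets M" for h x
    by measurable
  \<comment> \<open>For each \<open>\<omega>\<close> exactly one pair of a history and a next parent
    has indicator 1.\<close>
  have 1: "\<phi> (parents \<omega>) (w (Suc m) \<omega>) = (\<Sum>h\<in>?S. \<Sum>x\<le>m. \<phi> h x *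
      indicator {\<omega> \<in> space M. ?H \<omega> = h \<and> w (Suc m) \<omega> = x} \<omega>)" if \<omega>: "\<omega> \<in> space M" for \<omega>
  proof -
    have pm: "parent_map (parents \<omega>)" using parent_map_parents[OF \<omega>] .
    then have "w (Suc m) \<omega> \<le> m" by (auto simp: parent_map_def less_Suc_eq_le)
    moreover have "(\<Sum>h\<in>?S. \<Sum>x\<le>m. \<phi> h x * indicator {\<omega> \<in> space M. ?H \<omega> = h \<and> w (Suc m) \<omega> = x} \<omega>)
        = (\<Sum>h\<in>?S. if ?H \<omega> = h then (\<Sum>x\<le>m. if w (Suc m) \<omega> = x then \<phi> h x else 0) else 0)"
      using \<omega> by (auto intro!: sum.cong simp: indicator_def)
    ultimately show ?thesis
      using H[OF \<omega>] depends_upto_cut[OF \<phi> pm] by (simp add: finite_cuts)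
  qed
  have 2: "(\<Sum>x\<le>m. f (indeg (parents \<omega>) m x) * \<phi> (parents \<omega>) x) / weight f (parents \<omega>) m =
      (\<Sum>h\<in>?S. (\<Sum>x\<le>m. f (indeg h m x) * \<phi> h x) / weight f h m * indicator {\<omega> \<in> space M. ?H \<omega> = h} \<omega>)"
    if \<omega>: "\<omega> \<in> space M" for \<omega>
  proof -
    have pm: "parent_map (parents \<omega>)" using parent_map_parents[OF \<omega>] .
    let ?\<psi> = "\<lambda>h. (\<Sum>x\<le>m. f (indeg h m x) * \<phi> h x) / weight f h m"
    have "depends_upto m ?\<psi>"
      by (rule depends_upto_compose2[OF depends_upto_compose2[OF depends_upto_indeg \<phi>] depends_upto_weight])
    from depends_upto_cut[OF this pm] have "?\<psi> (?H \<omega>) = ?\<psi> (parents \<omega>)" .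
    moreover have "(\<Sum>h\<in>?S. ?\<psi> h * indicator {\<omega> \<in> space M. ?H \<omega> = h} \<omega>)
        = (\<Sum>h\<in>?S. if ?H \<omega> = h then ?\<psi> h else 0)"
      using \<omega> by (auto intro!: sum.cong simp: indicator_def)
    ultimately show ?thesis
      using H[OF \<omega>] by (simp add: finite_cuts)
  qed
  have "expectation (\<lambda>\<omega>. \<phi> (parents \<omega>) (w (Suc m) \<omega>)) = expectation (\<lambda>\<omega>. \<Sum>h\<in>?S. \<Sum>x\<le>m. \<phi> h x *
      indicator {\<omega> \<in> space M. ?H \<omega> = h \<and> w (Suc m) \<omega> = x} \<omega>)"
    by (intro Bochner_Integration.integral_cong refl 1)
  also have "\<dots> = (\<Sum>h\<in>?S. \<Sum>x\<le>m. \<phi> h x * prob {\<omega> \<in> space M. ?H \<omega> = h \<and> w (Suc m) \<omega> = x})"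
    by (simp add: Bochner_Integration.integral_sum emeasure_eq_measure
        del: sum_mult_indicator)
  also have "\<dots> = (\<Sum>h\<in>?S. \<Sum>x\<le>m. \<phi> h x * (prob {\<omega> \<in> space M. ?H \<omega> = h} * (f (indeg h m x) / weight f h m)))"
    by (intro sum.cong refl arg_cong2[where f = "(*)"] prob_next_parent) auto
  also have "\<dots> = (\<Sum>h\<in>?S. (\<Sum>x\<le>m. f (indeg h m x) * \<phi> h x) / weight f h m * prob {\<omega> \<in> space M. ?H \<omega> = h})"
    by (auto simp: sum_divide_distrib sum_distrib_left sum_distrib_right ac_simps intro!: sum.cong)
  also have "\<dots> = expectation (\<lambda>\<omega>. \<Sum>h\<in>?S. (\<Sum>x\<le>m. f (indeg h m x) * \<phi> h x) / weight f h m *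
      indicator {\<omega> \<in> space M. ?H \<omega> = h} \<omega>)"
    by (simp add: Bochner_Integration.integral_sum emeasure_eq_measure
        del: sum_mult_indicator)
  also have "\<dots> = expectation (\<lambda>\<omega>. (\<Sum>x\<le>m. f (indeg (parents \<omega>) m x) * \<phi> (parents \<omega>) x) / weight f (parents \<omega>) m)"
    by (intro Bochner_Integration.integral_cong refl 2[symmetric])
  finally show ?thesis .
qed

text \<open>\<open>expectation_step\<close> for an indicator: given a past in \<open>A\<close>, the
  next parent lies in \<open>S\<close> with probability equal to the share of \<open>S\<close> in
  the total weight, which is at most \<open>a\<close>.\<close>

lemma prob_step_le:
  assumes A: "depends_upto m A" and S: "depends_upto m S"
    and bound: "\<And>h. parent_map h \<Longrightarrow> A h \<Longrightarrow>
        (\<Sum>x\<in>S h \<inter> {..m}. f (indeg h m x)) \<le> a * weight f h m"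
  shows "prob {\<omega> \<in> space M. A (parents \<omega>) \<and> w (Suc m) \<omega> \<in> S (parents \<omega>)}
       \<le> a * prob {\<omega> \<in> space M. A (parents \<omega>)}"
proof -
  let ?\<phi> = "\<lambda>h x. of_bool (A h \<and> x \<in> S h) :: real"
  let ?B = "{\<omega> \<in> space M. A (parents \<omega>) \<and> w (Suc m) \<omega> \<in> S (parents \<omega>)}"
  have wm [measurable]: "w (Suc m) \<in> M \<rightarrow>\<^sub>M count_space UNIV" by (rule rv_w)
  have \<phi>: "depends_upto m ?\<phi>" by (rule depends_upto_compose2[OF A S])
  have Am [measurable]: "{\<omega> \<in> space M. A (parents \<omega>)} \<in> sets M" by (rule depends_upto_sets[OF A])
  have "prob ?B = prob (?B \<inter> space M)" by (intro arg_cong[where f = prob]) auto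
  also have "\<dots> = expectation (indicator ?B)" by simp
  also have "\<dots> = expectation (\<lambda>\<omega>. ?\<phi> (parents \<omega>) (w (Suc m) \<omega>))"
    by (intro Bochner_Integration.integral_cong) (auto simp: indicator_def)
  also have "\<dots> = expectation (\<lambda>\<omega>. (\<Sum>x\<le>m. f (indeg (parents \<omega>) m x) * ?\<phi> (parents \<omega>) x) / weight f (parents \<omega>) m)"
    by (rule expectation_step[OF \<phi>])
  also have "\<dots> \<le> expectation (\<lambda>\<omega>. a * indicator {\<omega> \<in> space M. A (parents \<omega>)} \<omega>)"
  proof (rule integral_mono)
    show "integrable M (\<lambda>\<omega>. (\<Sum>x\<le>m. f (indeg (parents \<omega>) m x) * ?\<phi> (parents \<omega>) x) / weight f (parents \<omega>) m)"
      by (rule depends_upto_integrable[where \<phi> = "\<lambda>h. (\<Sum>x\<le>m. f (indeg h m x) * ?\<phi> h x) / weight f h m"])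
         (rule depends_upto_compose2[OF depends_upto_compose2[OF depends_upto_indeg \<phi>] depends_upto_weight])
    show "integrable M (\<lambda>\<omega>. a * indicator {\<omega> \<in> space M. A (parents \<omega>)} \<omega>)"
      by (simp add: integrable_real_indicator emeasure_eq_measure)
    fix \<omega> assume \<omega>: "\<omega> \<in> space M"
    have pos: "weight f (parents \<omega>) m > 0" by (intro weight_pos kernel_pos)
    show "(\<Sum>x\<le>m. f (indeg (parents \<omega>) m x) * ?\<phi> (parents \<omega>) x) / weight f (parents \<omega>) m
        \<le> a * indicator {\<omega> \<in> space M. A (parents \<omega>)} \<omega>"
    proof (cases "A (parents \<omega>)")
      case True
      have "(\<Sum>x\<le>m. f (indeg (parents \<omega>) m x) * ?\<phi> (parents \<omega>) x)
          = (\<Sum>x\<in>S (parents \<omega>) \<inter> {..m}. f (indeg (parents \<omega>) m x))"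
        using True by (intro sum.mono_neutral_cong_right) auto
      also have "\<dots> \<le> a * weight f (parents \<omega>) m"
        using bound True parent_map_parents[OF \<omega>] by blast
      finally show ?thesis using True \<omega> pos by (simp add: field_simps)
    qed (use \<omega> in simp)
  qed
  also have "\<dots> = a * prob {\<omega> \<in> space M. A (parents \<omega>)}" by simp
  finally show ?thesis .
qed

end

section \<open>The initial growth of the total weight\<close>

lemma powr_diff_ge:
  fixes x s :: real
  assumes "x > 0" "s > 1"
  shows "(s - 1) * (x + 1) powr (- s) \<le> x powr (1 - s) - (x + 1) powr (1 - s)"
proof -
  have "\<exists>z>x. z < x + 1 \<and> (x + 1) powr (1 - s) - x powr (1 - s) = (x + 1 - x) * ((1 - s) * z powr (1 - s - 1))"
    using assms by (intro MVT2 has_real_derivative_powr) auto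
  then obtain z where z: "x < z" "z < x + 1"
    and eq: "(x + 1) powr (1 - s) - x powr (1 - s) = (1 - s) * z powr (- s)"
    by auto
  have "(x + 1) powr (- s) \<le> z powr (- s)"
    using assms z by (intro powr_mono2') auto
  then have "(s - 1) * (x + 1) powr (- s) \<le> (s - 1) * z powr (- s)"
    using assms by (intro mult_left_mono) auto
  then show ?thesis using eq by (simp add: algebra_simps)
qed

lemma powr_diff_le:
  fixes x d :: real
  assumes "x > 0" "d \<ge> 0"
  shows "(x + 1) powr (1 + d) - x powr (1 + d) \<le> (1 + d) * (x + 1) powr d"
proof -
  have "\<exists>z>x. z < x + 1 \<and> (x + 1) powr (1 + d) - x powr (1 + d) = (x + 1 - x) * ((1 + d) * z powr (1 + d - 1))"
    using assms by (intro MVT2 has_real_derivative_powr) auto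
  then obtain z where z: "x < z" "z < x + 1"
    and eq: "(x + 1) powr (1 + d) - x powr (1 + d) = (1 + d) * z powr d"
    by auto
  have "z powr d \<le> (x + 1) powr d"
    using assms z by (intro powr_mono2) auto
  then show ?thesis unfolding eq using assms by (intro mult_left_mono) auto
qed

text \<open>Telescoping of \<open>powr_diff_le\<close>; the start is
  \<open>1 \<le> 1 + d\<close>.\<close>

lemma powr_Suc_le_sum_powr:
  fixes d :: real
  assumes "d \<ge> 0"
  shows "(real m + 1) powr (1 + d) \<le> (1 + d) * (\<Sum>j\<le>m. (real j + 1) powr d)"
proof (induction m)
  case (Suc m)
  then show ?case
    using powr_diff_le[of "real m + 1" d] assms by (simp add: algebra_simps)
qed (use assms in simp)

text \<open>Combine \<open>(1 + 1 / x) powr d \<le> exp (d / x)\<close> with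
  \<open>1 - d / x \<le> exp (- (d / x))\<close>.\<close>

lemma powr_shift_le:
  fixes x d :: real
  assumes "x > 0" "d \<ge> 0"
  shows "(x + 1) powr d * (1 - d / x) \<le> x powr d"
proof -
  have "(x + 1) powr d = x powr d * (1 + 1 / x) powr d"
  proof -
    have "x + 1 = x * (1 + 1 / x)" using assms by (simp add: field_simps)
    then show ?thesis using assms by (metis powr_mult)
  qed
  also have "(1 + 1 / x) powr d = exp (d * ln (1 + 1 / x))"
  proof -
    have "1 + 1 / x > 0" using assms by (simp add: add_pos_pos)
    then show ?thesis by (simp add: powr_def)
  qed
  also have "\<dots> \<le> exp (d / x)"
    using assms ln_add_one_self_le_self[of "1 / x"]
    by (auto simp: divide_inverse intro!: mult_left_mono)
  finally have 1: "(x + 1) powr d \<le> x powr d * exp (d / x)"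
    by (simp add: mult_left_mono)
  have 2: "1 - d / x \<le> exp (- (d / x))"
    using exp_ge_add_one_self[of "- (d / x)"] by simp
  have "(x + 1) powr d * (1 - d / x) \<le> (x + 1) powr d * exp (- (d / x))"
    using 2 by (intro mult_left_mono) auto
  also have "\<dots> \<le> x powr d * exp (d / x) * exp (- (d / x))"
    using 1 by (intro mult_right_mono) auto
  also have "\<dots> = x powr d" by (simp add: exp_minus)
  finally show ?thesis .
qed

text \<open>Telescoping of \<open>powr_diff_ge\<close>, in place of a comparison with an
  integral.\<close>

lemma sum_powr_tail_le:
  fixes s :: real
  assumes "s > 1" "r \<ge> 1" "r \<le> m"
  shows "(\<Sum>j\<in>{r..<m}. (real j + 1) powr (- s)) \<le> (real r powr (1 - s) - real m powr (1 - s)) / (s - 1)"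
  using \<open>r \<le> m\<close>
proof (induction m rule: dec_induct)
  case (step m)
  have "(real m + 1) powr (- s) \<le> (real m powr (1 - s) - (real m + 1) powr (1 - s)) / (s - 1)"
    using powr_diff_ge[of "real m" s] assms step.hyps by (simp add: field_simps)
  then show ?case
    using step by (simp add: diff_divide_distrib algebra_simps)
qed simp

section \<open>Maximal degree and total weight\<close>

definition maxdeg :: "(nat \<Rightarrow> nat) \<Rightarrow> nat \<Rightarrow> nat" where
  "maxdeg h m = Max (indeg h m ` {..m})"

lemma indeg_le_maxdeg: "v \<le> m \<Longrightarrow> indeg h m v \<le> maxdeg h m"
  unfolding maxdeg_def by (intro Max_ge) auto

lemma maxdeg_attained: "\<exists>v\<le>m. indeg h m v = maxdeg h m"
proof -
  have "maxdeg h m \<in> indeg h m ` {..m}" unfolding maxdeg_def by (intro Max_in) auto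
  then show ?thesis by auto
qed

lemma maxdeg_cong: "(\<And>j. 1 \<le> j \<Longrightarrow> j \<le> m \<Longrightarrow> h j = h' j) \<Longrightarrow> maxdeg h m = maxdeg h' m"
  unfolding maxdeg_def using indeg_cong[of m h h'] by auto

lemma depends_upto_maxdeg: "depends_upto m (\<lambda>h. maxdeg h m)"
  by (intro depends_uptoI maxdeg_cong) auto

lemma indeg_Suc: "indeg h (Suc m) v = indeg h m v + of_bool (h (Suc m) = v)"
proof -
  have "{j \<in> {1..Suc m}. h j = v} =
      (if h (Suc m) = v then insert (Suc m) {j \<in> {1..m}. h j = v} else {j \<in> {1..m}. h j = v})"
    by (auto simp: le_Suc_eq)
  then show ?thesis by (simp add: indeg_def)
qed

lemma maxdeg_Suc_ge: "maxdeg h m \<le> maxdeg h (Suc m)"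
proof -
  obtain v where "v \<le> m" "indeg h m v = maxdeg h m" using maxdeg_attained by blast
  then show ?thesis using indeg_le_maxdeg[of v "Suc m" h] by (simp add: indeg_Suc)
qed

lemma maxdeg_Suc_gt:
  "v \<le> m \<Longrightarrow> indeg h m v = maxdeg h m \<Longrightarrow> h (Suc m) = v \<Longrightarrow> maxdeg h m + 1 \<le> maxdeg h (Suc m)"
  using indeg_le_maxdeg[of v "Suc m" h] by (simp add: indeg_Suc)

text \<open>Each of the \<open>m\<close> edges is counted once, at its parent. In the induction the
  node \<open>Suc m\<close> enters the index range with degree 0.\<close>

lemma sum_indeg:
  assumes "parent_map h"
  shows "(\<Sum>v\<le>m. indeg h m v) = m"
proof (induction m)
  case (Suc m)
  have "h (Suc m) \<le> Suc m" using assms by (auto simp: parent_map_def intro: less_imp_le)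
  moreover have "indeg h m (Suc m) = 0"
    using assms by (fastforce simp: indeg_def parent_map_def)
  ultimately show ?case
    using Suc by (simp add: indeg_Suc sum.distrib of_bool_def del: sum.atMost_Suc)
                 (simp add: sum.distrib)
qed (simp add: indeg_def)

text \<open>Split one factor \<open>d + 1\<close> off \<open>(d + 1) powr p\<close> and bound the
  rest by the maximal degree; the factors split off add up to \<open>2 * m + 1\<close> by
  \<open>sum_indeg\<close>.\<close>

lemma weight_le_maxdeg:
  assumes "parent_map h" "p \<ge> 1"
  shows "weight (\<lambda>x. (real x + 1) powr p) h m \<le> (2 * real m + 1) * (real (maxdeg h m) + 1) powr (p - 1)"
proof -
  have "weight (\<lambda>x. (real x + 1) powr p) h m
      \<le> (\<Sum>v\<le>m. (real (indeg h m v) + 1) * (real (maxdeg h m) + 1) powr (p - 1))"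
    unfolding weight_def
  proof (rule sum_mono)
    fix v assume "v \<in> {..m}"
    then have "(real (indeg h m v) + 1) powr (p - 1) \<le> (real (maxdeg h m) + 1) powr (p - 1)"
      using indeg_le_maxdeg[of v m h] assms by (intro powr_mono2) auto
    moreover have "(real (indeg h m v) + 1) powr p
        = (real (indeg h m v) + 1) * (real (indeg h m v) + 1) powr (p - 1)"
      by (simp add: powr_diff)
    ultimately show "(real (indeg h m v) + 1) powr p
        \<le> (real (indeg h m v) + 1) * (real (maxdeg h m) + 1) powr (p - 1)"
      by (simp add: mult_left_mono)
  qed
  also have "\<dots> = (real (\<Sum>v\<le>m. indeg h m v) + real m + 1) * (real (maxdeg h m) + 1) powr (p - 1)"
    by (simp add: sum_distrib_right[symmetric] sum.distrib)
  finally show ?thesis using sum_indeg[OF assms(1)] by simp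
qed

lemma maxdeg_le_weight:
  "(real (maxdeg h m) + 1) powr p \<le> weight (\<lambda>x. (real x + 1) powr p) h m"
proof -
  obtain v where "v \<le> m" "indeg h m v = maxdeg h m" using maxdeg_attained by blast
  then show ?thesis
    using member_le_sum[of v "{..m}" "\<lambda>v. (real (indeg h m v) + 1) powr p"] by (simp add: weight_def)
qed

text \<open>Degrees never decrease, and new nodes contribute nonnegative terms.\<close>

lemma weight_mono:
  assumes "p \<ge> 0" "m \<le> n"
  shows "weight (\<lambda>x. (real x + 1) powr p) h m \<le> weight (\<lambda>x. (real x + 1) powr p) h n"
  using assms(2)
proof (induction n rule: dec_induct)
  case (step n)
  have "weight (\<lambda>x. (real x + 1) powr p) h n \<le> (\<Sum>v\<le>n. (real (indeg h (Suc n) v) + 1) powr p)"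
    unfolding weight_def using assms(1) by (intro sum_mono powr_mono2) (auto simp: indeg_Suc)
  also have "\<dots> \<le> weight (\<lambda>x. (real x + 1) powr p) h (Suc n)"
    by (simp add: weight_def)
  finally show ?case using step by linarith
qed simp

section \<open>A decreasing potential and the first lower bound on the total weight\<close>

locale superlinear_GN = GN_process M "\<lambda>x. (real x + 1) powr p" w T
  for M :: "'a measure" and p :: real and w :: "nat \<Rightarrow> 'a \<Rightarrow> nat"
    and T :: "nat \<Rightarrow> 'a \<Rightarrow> nat pair_pre_digraph" +
  assumes p_gt_1: "p > 1"
begin

abbreviation Z :: "(nat \<Rightarrow> nat) \<Rightarrow> nat \<Rightarrow> real" where
  "Z \<equiv> weight (\<lambda>x. (real x + 1) powr p)"

lemma Z_pos: "Z h m > 0"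
  by (intro weight_pos) auto

abbreviation potential :: "(nat \<Rightarrow> nat) \<Rightarrow> nat \<Rightarrow> real" where
  "potential h m \<equiv> (real (maxdeg h m) + 1) powr (1 - p)"

text \<open>The constant \<open>\<kappa>\<close> of the introduction. The factor
  \<open>2 powr (- p)\<close> pays for replacing \<open>D + 2\<close> by
  \<open>2 * (D + 1)\<close>.\<close>

definition drift :: real where
  "drift = (p - 1) * 2 powr (- p)"

lemma drift_pos: "drift > 0"
  using p_gt_1 by (simp add: drift_def)

lemma potential_drop:
  fixes D :: nat
  shows "drift * (real D + 1) powr (- p) \<le> (real D + 1) powr (1 - p) - (real D + 2) powr (1 - p)"
proof -
  have "(2 * (real D + 1)) powr (- p) \<le> (real D + 2) powr (- p)"
    using p_gt_1 by (intro powr_mono2') auto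
  then have "2 powr (- p) * (real D + 1) powr (- p) \<le> (real D + 2) powr (- p)"
    by (subst (asm) powr_mult) auto
  then have "(p - 1) * (2 powr (- p) * (real D + 1) powr (- p)) \<le> (p - 1) * (real D + 2) powr (- p)"
    using p_gt_1 by (intro mult_left_mono) auto
  also have "\<dots> \<le> (real D + 1) powr (1 - p) - (real D + 2) powr (1 - p)"
    using powr_diff_ge[of "real D + 1" p] p_gt_1 by (simp add: add.commute)
  finally show ?thesis by (simp add: drift_def mult.assoc)
qed

text \<open>The potential never increases, and it drops by at least
  \<open>drift * (D + 1) powr (- p)\<close> when the new edge goes to a node of maximal degree
  \<open>D\<close>, an event of conditional probability at least
  \<open>(D + 1) powr p / Z\<close>.\<close>

lemma potential_step:
  "expectation (\<lambda>\<omega>. potential (parents \<omega>) (Suc m))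
     \<le> expectation (\<lambda>\<omega>. potential (parents \<omega>) m - drift / Z (parents \<omega>) m)"
proof -
  \<comment> \<open>The next potential as a function of the past and of the next parent
    \<open>x\<close>, the form that \<open>expectation_step\<close> requires.\<close>
  let ?\<phi> = "\<lambda>h x. potential (h(Suc m := x)) (Suc m)"
  let ?f = "\<lambda>h x. (real (indeg h m x) + 1) powr p"
  have \<phi>: "depends_upto m ?\<phi>"
  proof (intro depends_uptoI ext)
    fix h h' :: "nat \<Rightarrow> nat" and x assume "\<And>j. 1 \<le> j \<Longrightarrow> j \<le> m \<Longrightarrow> h j = h' j"
    then have "maxdeg (h(Suc m := x)) (Suc m) = maxdeg (h'(Suc m := x)) (Suc m)"
      by (intro maxdeg_cong) (auto simp: le_Suc_eq)
    then show "?\<phi> h x = ?\<phi> h' x" by simp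
  qed
  have "expectation (\<lambda>\<omega>. potential (parents \<omega>) (Suc m)) = expectation (\<lambda>\<omega>. ?\<phi> (parents \<omega>) (w (Suc m) \<omega>))"
  proof (intro Bochner_Integration.integral_cong refl)
    fix \<omega>
    have "(parents \<omega>)(Suc m := w (Suc m) \<omega>) = parents \<omega>" by auto
    then show "potential (parents \<omega>) (Suc m) = ?\<phi> (parents \<omega>) (w (Suc m) \<omega>)" by simp
  qed
  also have "\<dots> = expectation (\<lambda>\<omega>. (\<Sum>x\<le>m. ?f (parents \<omega>) x * ?\<phi> (parents \<omega>) x) / Z (parents \<omega>) m)"
    by (rule expectation_step[OF \<phi>])
  also have "\<dots> \<le> expectation (\<lambda>\<omega>. potential (parents \<omega>) m - drift / Z (parents \<omega>) m)"
  proof (rule integral_mono)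
    show "integrable M (\<lambda>\<omega>. (\<Sum>x\<le>m. ?f (parents \<omega>) x * ?\<phi> (parents \<omega>) x) / Z (parents \<omega>) m)"
      by (rule depends_upto_integrable[where \<phi> = "\<lambda>h. (\<Sum>x\<le>m. ?f h x * ?\<phi> h x) / Z h m"])
         (rule depends_upto_compose2[OF depends_upto_compose2[OF depends_upto_indeg \<phi>] depends_upto_weight])
    show "integrable M (\<lambda>\<omega>. potential (parents \<omega>) m - drift / Z (parents \<omega>) m)"
      by (rule depends_upto_integrable[where \<phi> = "\<lambda>h. potential h m - drift / Z h m"],
          rule depends_upto_compose2[OF depends_upto_maxdeg depends_upto_weight,
            where g = "\<lambda>D z. (real D + 1) powr (1 - p) - drift / z"])
    fix \<omega> assume "\<omega> \<in> space M"
    let ?h = "parents \<omega>"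
    \<comment> \<open>A single node of maximal degree suffices; the drop is credited only when the
      new edge goes to \<open>v\<close>.\<close>
    obtain v where v: "v \<le> m" "indeg ?h m v = maxdeg ?h m" using maxdeg_attained by blast
    let ?D = "maxdeg ?h m"
    have upd: "maxdeg (?h(Suc m := x)) m = ?D" "indeg (?h(Suc m := x)) m = indeg ?h m" for x
      by (auto intro!: maxdeg_cong indeg_cong)
    have le: "?\<phi> ?h x \<le> potential ?h m" for x
      using maxdeg_Suc_ge[of "?h(Suc m := x)" m] p_gt_1 by (intro powr_mono2') (auto simp: upd)
    have "?\<phi> ?h v \<le> (real ?D + 2) powr (1 - p)"
      using maxdeg_Suc_gt[of v m "?h(Suc m := v)"] v p_gt_1 by (intro powr_mono2') (auto simp: upd)
    then have lev: "?\<phi> ?h v \<le> potential ?h m - drift * (real ?D + 1) powr (- p)"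
      using potential_drop[of ?D] by linarith
    have "(\<Sum>x\<le>m. ?f ?h x * ?\<phi> ?h x)
        \<le> (\<Sum>x\<le>m. ?f ?h x * potential ?h m - (if x = v then drift else 0))"
    proof (rule sum_mono)
      fix x assume "x \<in> {..m}"
      show "?f ?h x * ?\<phi> ?h x \<le> ?f ?h x * potential ?h m - (if x = v then drift else 0)"
      proof (cases "x = v")
        case True
        have "?f ?h v * ?\<phi> ?h v \<le> ?f ?h v * (potential ?h m - drift * (real ?D + 1) powr (- p))"
          by (rule mult_left_mono[OF lev]) simp
        \<comment> \<open>The weight of \<open>v\<close> is \<open>(D + 1) powr p\<close> and
          cancels \<open>(D + 1) powr (- p)\<close>.\<close>
        also have "\<dots> = ?f ?h v * potential ?h m - drift"
          using v by (simp add: right_diff_distrib powr_minus field_simps)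
        finally show ?thesis using True by simp
      next
        case False
        then show ?thesis using le[of x] by (simp add: mult_left_mono)
      qed
    qed
    also have "\<dots> = Z ?h m * potential ?h m - drift"
      using v by (simp add: sum_subtractf weight_def sum_distrib_right)
    finally show "(\<Sum>x\<le>m. ?f ?h x * ?\<phi> ?h x) / Z ?h m \<le> potential ?h m - drift / Z ?h m"
      using Z_pos[of ?h m] by (simp add: field_simps)
  qed
  finally show ?thesis .
qed

text \<open>The rescaled mean potential \<open>?\<Phi>\<close> loses at least
  \<open>drift / 2 * expectation (?g m)\<close> in each step, so the series of the
  \<open>?g m\<close> converges almost surely. Monotonicity of \<open>Z\<close> turns this into a
  lower bound with exponent \<open>1 + d\<close>.\<close>

lemma initial_growth:
  "\<exists>q>1. AE \<omega> in M. \<exists>c>0. \<forall>m. c * (real m + 1) powr q \<le> Z (parents \<omega>) m"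
proof -
  \<comment> \<open>Half of the drift, combined with \<open>Z * potential \<le> 2 * (m + 1)\<close>,
    is a relative decrease of the potential by \<open>drift / 4 / (m + 1)\<close>. This is exactly
    what the factor \<open>(m + 1) powr d\<close> may use up.\<close>
  define d where "d = drift / 4"
  have d: "d > 0" using drift_pos by (simp add: d_def)
  let ?\<Phi> = "\<lambda>m. (real m + 1) powr d * expectation (\<lambda>\<omega>. potential (parents \<omega>) m)"
  let ?g = "\<lambda>m \<omega>. (real m + 1) powr d / Z (parents \<omega>) m"
  have int_pot: "integrable M (\<lambda>\<omega>. potential (parents \<omega>) m)" for m
    by (rule depends_upto_integrable[where \<phi> = "\<lambda>h. potential h m"],
        rule depends_upto_compose[OF depends_upto_maxdeg, where g = "\<lambda>D. (real D + 1) powr (1 - p)"])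
  have int_g: "integrable M (\<lambda>\<omega>. c / Z (parents \<omega>) m)" for c m
    by (rule depends_upto_integrable[where \<phi> = "\<lambda>h. c / Z h m"],
        rule depends_upto_compose[OF depends_upto_weight, where g = "\<lambda>z. c / z"])
  have step: "?\<Phi> (Suc m) + drift / 2 * expectation (?g m) \<le> ?\<Phi> m" for m
  proof -
    have "?\<Phi> (Suc m) \<le> (real (Suc m) + 1) powr d * expectation (\<lambda>\<omega>. potential (parents \<omega>) m - drift / Z (parents \<omega>) m)"
      by (intro mult_left_mono potential_step) auto
    also have "\<dots> = expectation (\<lambda>\<omega>. (real (Suc m) + 1) powr d * (potential (parents \<omega>) m - drift / Z (parents \<omega>) m))"
      by simp
    also have "\<dots> \<le> expectation (\<lambda>\<omega>. (real m + 1) powr d * potential (parents \<omega>) m - drift / 2 * ?g m \<omega>)"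
    proof (rule integral_mono)
      show "integrable M (\<lambda>\<omega>. (real (Suc m) + 1) powr d * (potential (parents \<omega>) m - drift / Z (parents \<omega>) m))"
        by (intro integrable_mult_right Bochner_Integration.integrable_diff int_pot int_g)
      show "integrable M (\<lambda>\<omega>. (real m + 1) powr d * potential (parents \<omega>) m - drift / 2 * ?g m \<omega>)"
        by (intro integrable_mult_right Bochner_Integration.integrable_diff int_pot int_g)
      fix \<omega> assume \<omega>: "\<omega> \<in> space M"
      let ?h = "parents \<omega>"
      let ?G = "potential ?h m" and ?x = "real m + 1"
      have "Z ?h m * ?G \<le> (2 * real m + 1) * (real (maxdeg ?h m) + 1) powr (p - 1) * ?G"
        using parent_map_parents[OF \<omega>] p_gt_1 by (intro mult_right_mono weight_le_maxdeg) auto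
      also have "\<dots> = 2 * real m + 1"
        by (simp add: mult.assoc powr_add[symmetric])
      also have "\<dots> \<le> 2 * ?x" by simp
      finally have ZG: "?G / (2 * ?x) \<le> 1 / Z ?h m"
        using Z_pos[of ?h m] by (simp add: field_simps)
      \<comment> \<open>The drift is cut into two halves: the first pays for the growth of the
        prefactor, the second survives as the multiple of \<open>?g m\<close>.\<close>
      have "(?x + 1) powr d * (?G - drift / Z ?h m)
          = (?x + 1) powr d * (?G - drift / 2 * (1 / Z ?h m)) - drift / 2 * ((?x + 1) powr d * (1 / Z ?h m))"
        by (simp add: algebra_simps)
      also have "\<dots> \<le> (?x + 1) powr d * (?G - drift / 2 * (?G / (2 * ?x))) - drift / 2 * (?x powr d * (1 / Z ?h m))"
      proof (rule diff_mono)
        have "drift / 2 * (?G / (2 * ?x)) \<le> drift / 2 * (1 / Z ?h m)"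
          using ZG drift_pos by (intro mult_left_mono) auto
        then show "(?x + 1) powr d * (?G - drift / 2 * (1 / Z ?h m))
            \<le> (?x + 1) powr d * (?G - drift / 2 * (?G / (2 * ?x)))"
          by (rule mult_left_mono[OF diff_left_mono]) simp
        have "?x powr d \<le> (?x + 1) powr d" using d by (intro powr_mono2) auto
        then show "drift / 2 * (?x powr d * (1 / Z ?h m)) \<le> drift / 2 * ((?x + 1) powr d * (1 / Z ?h m))"
          using drift_pos Z_pos[of ?h m] by (intro mult_left_mono mult_right_mono) auto
      qed
      also have "(?x + 1) powr d * (?G - drift / 2 * (?G / (2 * ?x))) = (?x + 1) powr d * (1 - d / ?x) * ?G"
        by (simp add: d_def field_simps)
      also have "\<dots> \<le> ?x powr d * ?G"
        using d by (intro mult_right_mono powr_shift_le) auto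
      finally show "(real (Suc m) + 1) powr d * (?G - drift / Z ?h m) \<le> ?x powr d * ?G - drift / 2 * ?g m \<omega>"
        by (simp add: add.commute)
    qed
    also have "\<dots> = ?\<Phi> m - drift / 2 * expectation (?g m)"
      by (subst Bochner_Integration.integral_diff)
         (auto intro!: integrable_mult_right int_pot int_g simp del: times_divide_eq_right times_divide_eq_left)
    finally show ?thesis by simp
  qed
  \<comment> \<open>The one-step inequalities telescope, and \<open>?\<Phi> n\<close> is
    nonnegative, so the partial sums stay bounded by a multiple of \<open>?\<Phi> 0\<close>.\<close>
  have "?\<Phi> n + drift / 2 * (\<Sum>j<n. expectation (?g j)) \<le> ?\<Phi> 0" for n
  proof (induction n)
    case (Suc n)
    then show ?case using step[of n] by (simp add: distrib_left)
  qed simp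
  moreover have "0 \<le> ?\<Phi> n" for n
    by (intro mult_nonneg_nonneg Bochner_Integration.integral_nonneg) auto
  ultimately have "drift / 2 * (\<Sum>j<n. expectation (?g j)) \<le> ?\<Phi> 0" for n
    by (smt (verit))
  then have "(\<Sum>j<n. expectation (?g j)) \<le> 2 / drift * ?\<Phi> 0" for n
    using drift_pos by (simp add: field_simps)
  then have "AE \<omega> in M. summable (\<lambda>j. ?g j \<omega>)"
    by (intro AE_summable_of_bounded_expectation int_g) (auto intro!: divide_nonneg_nonneg less_imp_le[OF Z_pos])
  then have "AE \<omega> in M. \<exists>c>0. \<forall>m. c * (real m + 1) powr (1 + d) \<le> Z (parents \<omega>) m"
  proof eventually_elim
    case (elim \<omega>)
    let ?h = "parents \<omega>"
    \<comment> \<open>The additional 1 makes \<open>S\<close> positive, so that \<open>1 / C\<close>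
      can serve as the constant.\<close>
    define S where "S = (\<Sum>j. ?g j \<omega>) + 1"
    have g0: "?g j \<omega> \<ge> 0" for j by (intro divide_nonneg_nonneg less_imp_le[OF Z_pos]) auto
    then have S: "S > 0" unfolding S_def using suminf_nonneg[OF elim] by (simp add: add_nonneg_pos)
    define C where "C = (1 + d) * S"
    have C: "C > 0" using d S by (simp add: C_def)
    have "(real m + 1) powr (1 + d) \<le> C * Z ?h m" for m
    proof -
      \<comment> \<open>Earlier weights are at most \<open>Z ?h m\<close>, which can therefore be
        pulled out of the sum.\<close>
      have "(\<Sum>j\<le>m. (real j + 1) powr d) \<le> (\<Sum>j\<le>m. ?g j \<omega> * Z ?h m)"
      proof (rule sum_mono)
        fix j assume "j \<in> {..m}"
        then have "Z ?h j \<le> Z ?h m" using p_gt_1 by (intro weight_mono) auto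
        then have "?g j \<omega> * Z ?h j \<le> ?g j \<omega> * Z ?h m" using g0 by (rule mult_left_mono)
        then show "(real j + 1) powr d \<le> ?g j \<omega> * Z ?h m" using Z_pos[of ?h j] by simp
      qed
      also have "\<dots> = (\<Sum>j\<le>m. ?g j \<omega>) * Z ?h m" by (simp add: sum_distrib_right)
      also have "\<dots> \<le> S * Z ?h m"
        using sum_le_suminf[OF elim, of "{..m}"] g0 Z_pos[of ?h m] unfolding S_def
        by (intro mult_right_mono) auto
      finally have "(1 + d) * (\<Sum>j\<le>m. (real j + 1) powr d) \<le> (1 + d) * (S * Z ?h m)"
        using d by (intro mult_left_mono) auto
      moreover have "(real m + 1) powr (1 + d) \<le> (1 + d) * (\<Sum>j\<le>m. (real j + 1) powr d)"
        using d by (intro powr_Suc_le_sum_powr) simp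
      ultimately show ?thesis unfolding C_def mult.assoc by linarith
    qed
    moreover have "y \<le> C * z \<Longrightarrow> 1 / C * y \<le> z" for y z
      using C by (simp add: field_simps)
    ultimately have "\<forall>m. 1 / C * (real m + 1) powr (1 + d) \<le> Z ?h m" by blast
    moreover have "1 / C > 0" using C by simp
    ultimately show ?case by blast
  qed
  then show ?thesis using d by (intro exI[of _ "1 + d"]) auto
qed

end

section \<open>Subtrees under a lower bound on the total weight\<close>

text \<open>Descendants in the infinite tree. The condition \<open>1 \<le> j\<close> leaves the root
  without a parent.\<close>

definition desc :: "(nat \<Rightarrow> nat) \<Rightarrow> nat \<Rightarrow> nat set" where
  "desc h r = {u. (u, r) \<in> {(j, h j) |j. 1 \<le> j}\<^sup>+}"

text \<open>Splits off the first edge of the path from \<open>u\<close>. This recursion replaces the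
  transitive closure in inductions on the node.\<close>

lemma desc_iff: "u \<in> desc h r \<longleftrightarrow> 1 \<le> u \<and> (h u = r \<or> h u \<in> desc h r)"
proof
  assume "u \<in> desc h r"
  then have "(u, r) \<in> {(j, h j) |j. 1 \<le> j}\<^sup>+" by (simp only: desc_def mem_Collect_eq)
  then show "1 \<le> u \<and> (h u = r \<or> h u \<in> desc h r)"
  proof (rule converse_tranclE)
    assume "(u, r) \<in> {(j, h j) |j. 1 \<le> j}"
    then show ?thesis by blast
  next
    fix y assume "(u, y) \<in> {(j, h j) |j. 1 \<le> j}" and y: "(y, r) \<in> {(j, h j) |j. 1 \<le> j}\<^sup>+"
    then have "1 \<le> u" "y = h u" by blast+
    with y show ?thesis by (simp only: desc_def mem_Collect_eq simp_thms)
  qed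
next
  assume u: "1 \<le> u \<and> (h u = r \<or> h u \<in> desc h r)"
  then have e: "(u, h u) \<in> {(j, h j) |j. 1 \<le> j}" by blast
  show "u \<in> desc h r"
  proof (cases "h u = r")
    case True
    then show ?thesis using r_into_trancl[OF e] by (simp only: desc_def mem_Collect_eq)
  next
    case False
    then have "h u \<in> desc h r" using u by blast
    then have "(h u, r) \<in> {(j, h j) |j. 1 \<le> j}\<^sup>+" by (simp only: desc_def mem_Collect_eq)
    from trancl_into_trancl2[OF e this] show ?thesis by (simp only: desc_def mem_Collect_eq)
  qed
qed

lemma desc_gt: "parent_map h \<Longrightarrow> u \<in> desc h r \<Longrightarrow> r < u"
proof (induction u rule: less_induct)
  case (less u)
  then have "1 \<le> u" "h u = r \<or> h u \<in> desc h r" using desc_iff[of u h r] by blast+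
  moreover from this less.prems(1) have "h u < u" by (auto simp: parent_map_def)
  ultimately show ?case using less.IH[of "h u"] less.prems(1) by auto
qed

text \<open>Names decrease along a path towards the root, so a path from \<open>u \<le> m\<close>
  uses only parents of nodes up to \<open>m\<close>.\<close>

lemma desc_cong:
  assumes "parent_map h" "\<And>j. 1 \<le> j \<Longrightarrow> j \<le> m \<Longrightarrow> h j = h' j" "u \<le> m"
  shows "u \<in> desc h r \<longleftrightarrow> u \<in> desc h' r"
  using assms(3)
proof (induction u rule: less_induct)
  case (less u)
  show ?case
  proof (cases "1 \<le> u")
    case True
    then have "h u < u" using assms(1) by (auto simp: parent_map_def)
    moreover have "h u = h' u" using assms(2) True less.prems by blast
    ultimately show ?thesis
      using less desc_iff[of u h r] desc_iff[of u h' r] by simp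
  next
    case False
    then show ?thesis using desc_iff[of u h r] desc_iff[of u h' r] by blast
  qed
qed

text \<open>For a parent map these are the descendants already present at time \<open>m\<close>,
  since a path from a node visits only older nodes.\<close>

definition descs :: "(nat \<Rightarrow> nat) \<Rightarrow> nat \<Rightarrow> nat \<Rightarrow> nat set" where
  "descs h m r = desc h r \<inter> {..m}"

lemma finite_descs [simp]: "finite (descs h m r)"
  by (simp add: descs_def)

lemma depends_upto_descs: "depends_upto m (\<lambda>h. descs h m)"
proof (intro depends_uptoI ext)
  fix h h' r assume "parent_map h" "\<And>j. 1 \<le> j \<Longrightarrow> j \<le> m \<Longrightarrow> h j = h' j"
  then show "descs h m r = descs h' m r"
    using desc_cong[of h m h' _ r] by (auto simp: descs_def)
qed

lemma descs_mono: "m \<le> n \<Longrightarrow> descs h m r \<subseteq> descs h n r"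
  by (auto simp: descs_def)

lemma descs_self: "parent_map h \<Longrightarrow> descs h r r = {}"
  using desc_gt[of h _ r] by (fastforce simp: descs_def)

lemma descs_Suc:
  assumes "parent_map h"
  shows "descs h (Suc m) r =
    (if h (Suc m) \<in> insert r (descs h m r) then insert (Suc m) (descs h m r) else descs h m r)"
proof -
  have "h (Suc m) \<le> m" using assms by (auto simp: parent_map_def less_Suc_eq_le)
  then have "Suc m \<in> desc h r \<longleftrightarrow> h (Suc m) \<in> insert r (descs h m r)"
    using desc_iff[of "Suc m" h r] by (auto simp: descs_def)
  then show ?thesis by (auto simp: descs_def le_Suc_eq)
qed

text \<open>Children of a node in the subtree of \<open>r\<close> are themselves descendants of
  \<open>r\<close>.\<close>

lemma indeg_le_card_descs:
  assumes "v \<in> insert r (descs h m r)"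
  shows "indeg h m v \<le> card (descs h m r)"
  unfolding indeg_def
proof (rule card_mono)
  show "{j \<in> {1..m}. h j = v} \<subseteq> descs h m r"
  proof
    fix j assume "j \<in> {j \<in> {1..m}. h j = v}"
    then show "j \<in> descs h m r"
      using assms desc_iff[of j h r] by (auto simp: descs_def)
  qed
qed simp

section \<open>The probability that a subtree becomes large\<close>

context superlinear_GN
begin

text \<open>The bound is imposed only up to time \<open>m\<close>, so the condition is determined by
  the past and can be combined with the one-step estimate.\<close>

definition fast :: "real \<Rightarrow> real \<Rightarrow> nat \<Rightarrow> (nat \<Rightarrow> nat) \<Rightarrow> bool" where
  "fast c q m h \<longleftrightarrow> (\<forall>j\<le>m. c * (real j + 1) powr q \<le> Z h j)"

lemma depends_upto_fast: "depends_upto m (fast c q m)"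
proof (rule depends_uptoI)
  fix h h' :: "nat \<Rightarrow> nat" assume "\<And>j. 1 \<le> j \<Longrightarrow> j \<le> m \<Longrightarrow> h j = h' j"
  then have "Z h j = Z h' j" if "j \<le> m" for j
    using that by (intro weight_cong) auto
  then show "fast c q m h = fast c q m h'" by (auto simp: fast_def)
qed

definition grown :: "real \<Rightarrow> real \<Rightarrow> nat \<Rightarrow> nat \<Rightarrow> nat \<Rightarrow> 'a set" where
  "grown c q r i m = {\<omega> \<in> space M. fast c q m (parents \<omega>) \<and> i \<le> card (descs (parents \<omega>) m r)}"

lemma depends_upto_grown:
  "depends_upto m (\<lambda>h. fast c q m h \<and> Q (card (descs h m r)))"
  by (rule depends_upto_compose2[OF depends_upto_fast depends_upto_descs,
        where g = "\<lambda>a b. a \<and> Q (card (b r))"])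

lemma grown_sets: "grown c q r i m \<in> sets M"
  unfolding grown_def
  by (rule depends_upto_sets[OF depends_upto_grown[where Q = "\<lambda>n. i \<le> n"]])

text \<open>A subtree with \<open>i < k\<close> descendants has at most \<open>k\<close> nodes, each
  of weight at most \<open>k powr p\<close>, while the total weight is at least
  \<open>c * (m + 1) powr q\<close>. The quotient bounds the chance that the next edge enters the
  subtree.\<close>

lemma grown_step:
  assumes "c > 0" "i < k"
  shows "prob (grown c q r (Suc i) (Suc m)) \<le> prob (grown c q r (Suc i) m) +
           real k * real k powr p / c * (real m + 1) powr (- q) * prob (grown c q r i m)"
proof -
  let ?a = "real k * real k powr p / c * (real m + 1) powr (- q)"
  let ?A = "\<lambda>h. fast c q m h \<and> card (descs h m r) = i"
  let ?S = "\<lambda>h. insert r (descs h m r)"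
  let ?E = "{\<omega> \<in> space M. ?A (parents \<omega>) \<and> w (Suc m) \<omega> \<in> ?S (parents \<omega>)}"
  have A: "depends_upto m ?A" by (rule depends_upto_grown)
  have S: "depends_upto m ?S"
    by (rule depends_upto_compose[OF depends_upto_descs, where g = "\<lambda>d. insert r (d r)"])
  have AS: "depends_upto (Suc m) (\<lambda>h. ?A h \<and> h (Suc m) \<in> ?S h)"
    by (rule depends_upto_compose2[where g = "(\<and>)"], rule depends_upto_mono[OF A], simp,
        rule depends_upto_compose2[where g = "(\<in>)"], simp add: depends_upto_def,
        rule depends_upto_mono[OF S], simp)
  have E: "?E \<in> sets M"
    by (rule depends_upto_sets[OF AS])
  \<comment> \<open>Either the subtree was already that large at time \<open>m\<close>, or it had
    exactly \<open>i\<close> descendants and the new node joined it. The condition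
    \<open>fast\<close> passes to the earlier time.\<close>
  have "grown c q r (Suc i) (Suc m) \<subseteq> grown c q r (Suc i) m \<union> ?E"
  proof
    fix \<omega> assume \<omega>: "\<omega> \<in> grown c q r (Suc i) (Suc m)"
    then have *: "\<omega> \<in> space M" "fast c q m (parents \<omega>)" "Suc i \<le> card (descs (parents \<omega>) (Suc m) r)"
      by (auto simp: grown_def fast_def)
    then show "\<omega> \<in> grown c q r (Suc i) m \<union> ?E"
      using descs_Suc[OF parent_map_parents[OF *(1)], of m r]
      by (auto simp: grown_def card_insert_if split: if_splits)
  qed
  then have "prob (grown c q r (Suc i) (Suc m)) \<le> prob (grown c q r (Suc i) m \<union> ?E)"
    using grown_sets E by (intro finite_measure_mono sets.Un)
  also have "\<dots> \<le> prob (grown c q r (Suc i) m) + prob ?E"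
    by (rule measure_Un_le[OF grown_sets E])
  also have "prob ?E \<le> ?a * prob {\<omega> \<in> space M. ?A (parents \<omega>)}"
  proof (rule prob_step_le[OF A S])
    fix h assume h: "?A h"
    have "(\<Sum>x\<in>?S h \<inter> {..m}. (real (indeg h m x) + 1) powr p) \<le> (\<Sum>x\<in>?S h \<inter> {..m}. real k powr p)"
    proof (rule sum_mono)
      fix x assume "x \<in> ?S h \<inter> {..m}"
      then have "indeg h m x \<le> i" using indeg_le_card_descs[of x r h m] h by auto
      then show "(real (indeg h m x) + 1) powr p \<le> real k powr p"
        using assms p_gt_1 by (intro powr_mono2) auto
    qed
    also have "\<dots> \<le> real k * real k powr p"
    proof -
      have "card (?S h \<inter> {..m}) \<le> card (?S h)" by (intro card_mono) auto
      also have "\<dots> \<le> k" using h assms card_insert_le_m1[of k "descs h m r" r] by (simp add: card_insert_if)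
      finally show ?thesis by (simp add: mult_right_mono)
    qed
    also have "\<dots> \<le> ?a * Z h m"
    proof -
      have "c * (real m + 1) powr q \<le> Z h m" using h by (auto simp: fast_def)
      then have "real k * real k powr p / c * (real m + 1) powr (- q) * (c * (real m + 1) powr q) \<le> ?a * Z h m"
        using assms by (intro mult_left_mono) auto
      then show ?thesis using assms by (simp add: powr_minus field_simps)
    qed
    finally show "(\<Sum>x\<in>?S h \<inter> {..m}. (real (indeg h m x) + 1) powr p) \<le> ?a * Z h m" .
  qed
  also have "?a * prob {\<omega> \<in> space M. ?A (parents \<omega>)} \<le> ?a * prob (grown c q r i m)"
    using assms by (intro mult_left_mono finite_measure_mono grown_sets) (auto simp: grown_def)
  finally show ?thesis by simp
qed

text \<open>Every further descendant costs the sum of the one-step bounds over all times from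
  \<open>r\<close> on, which is at most a constant times \<open>r powr (1 - q)\<close>; this gives
  one factor for each of the \<open>i\<close> descendants.\<close>

lemma prob_grown_le:
  assumes c: "c > 0" and q: "q > 1" and r: "r \<ge> 1"
    and i: "i \<le> k" and m: "r \<le> m"
  shows "prob (grown c q r i m) \<le> (real k * real k powr p / c / (q - 1) * real r powr (1 - q)) ^ i"
  using i m
proof (induction i arbitrary: m)
  case (Suc i)
  define K where "K = real k * real k powr p / c"
  define B where "B = K / (q - 1) * real r powr (1 - q)"
  have K: "K \<ge> 0" using c by (simp add: K_def)
  then have B: "B \<ge> 0" using q by (simp add: B_def)
  have IH: "prob (grown c q r i j) \<le> B ^ i" if "r \<le> j" for j
    using Suc.IH[OF _ that] Suc.prems by (simp add: B_def K_def)
  \<comment> \<open>Inner induction on time, starting at \<open>r\<close>, when the node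
    \<open>r\<close> is new and has no descendants.\<close>
  have "prob (grown c q r (Suc i) m) \<le> (\<Sum>j\<in>{r..<m}. K * (real j + 1) powr (- q)) * B ^ i"
    using Suc.prems(2)
  proof (induction m rule: dec_induct)
    case base
    have "grown c q r (Suc i) r = {}"
      using descs_self parent_map_parents by (auto simp: grown_def)
    then show ?case by simp
  next
    case (step m)
    have "prob (grown c q r (Suc i) (Suc m)) \<le> prob (grown c q r (Suc i) m) +
        K * (real m + 1) powr (- q) * prob (grown c q r i m)"
      using grown_step[OF c, of i k q r m] Suc.prems by (simp add: K_def)
    also have "\<dots> \<le> (\<Sum>j\<in>{r..<m}. K * (real j + 1) powr (- q)) * B ^ i + K * (real m + 1) powr (- q) * B ^ i"
      using step.IH IH step.hyps K by (intro add_mono mult_left_mono) auto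
    finally show ?case using step.hyps by (simp add: distrib_right)
  qed
  also have "\<dots> \<le> B * B ^ i"
  proof (rule mult_right_mono)
    have "(\<Sum>j\<in>{r..<m}. K * (real j + 1) powr (- q)) = K * (\<Sum>j\<in>{r..<m}. (real j + 1) powr (- q))"
      by (simp add: sum_distrib_left)
    also have "\<dots> \<le> K * ((real r powr (1 - q) - real m powr (1 - q)) / (q - 1))"
      using K q r Suc.prems by (intro mult_left_mono sum_powr_tail_le) auto
    also have "\<dots> \<le> K * (real r powr (1 - q) / (q - 1))"
      using K q by (intro mult_left_mono divide_right_mono) auto
    finally show "(\<Sum>j\<in>{r..<m}. K * (real j + 1) powr (- q)) \<le> B" by (simp add: B_def)
  qed (use B in auto)
  finally show ?case by (simp add: B_def K_def)
qed simp

text \<open>Borel-Cantelli over \<open>r\<close>: on the event of fast growth the node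
  \<open>r\<close> ever has \<open>k\<close> descendants with probability at most a constant times
  \<open>r powr (- (k * (q - 1)))\<close>, which is summable.\<close>

lemma AE_finite_large_if_fast:
  assumes c: "c > 0" and q: "q > 1" and k: "real k * (q - 1) > 1"
  shows "AE \<omega> in M. (\<forall>m. c * (real m + 1) powr q \<le> Z (parents \<omega>) m) \<longrightarrow>
           finite {r. \<exists>m. k \<le> card (descs (parents \<omega>) m r)}"
proof -
  define K where "K = real k * real k powr p / c / (q - 1)"
  \<comment> \<open>\<open>grown c q r 0 n\<close> is merely the growth condition up to time
    \<open>n\<close>. Intersecting over all \<open>n\<close> makes \<open>A r m\<close> increasing
    in \<open>m\<close>, whereas \<open>grown\<close> itself need not be, as its growth condition
    tightens with time.\<close>
  define A where "A r m = (\<Inter>n. grown c q r 0 n) \<inter> grown c q r k m" for r m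
  have A: "A r m \<in> sets M" for r m
    unfolding A_def using grown_sets by (intro sets.Int sets.countable_INT) auto
  have fast_all: "\<omega> \<in> (\<Inter>n. grown c q r 0 n) \<longleftrightarrow>
      \<omega> \<in> space M \<and> (\<forall>m. c * (real m + 1) powr q \<le> Z (parents \<omega>) m)" for \<omega> r
    by (auto simp: grown_def fast_def)
  have A_iff: "\<omega> \<in> A r m \<longleftrightarrow> \<omega> \<in> space M \<and> (\<forall>m. c * (real m + 1) powr q \<le> Z (parents \<omega>) m) \<and>
      k \<le> card (descs (parents \<omega>) m r)" for \<omega> r m
    unfolding A_def Int_iff fast_all by (auto simp: grown_def fast_def)
  have bound: "prob (\<Union>m. A r m) \<le> K ^ k * real r powr (- (real k * (q - 1)))" if r: "r \<ge> 1" for r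
  proof -
    have "incseq (A r)"
    proof (intro incseq_SucI subsetI)
      fix m \<omega> assume "\<omega> \<in> A r m"
      then show "\<omega> \<in> A r (Suc m)"
        using card_mono[OF finite_descs descs_mono[of m "Suc m" "parents \<omega>" r]]
        by (auto simp: A_iff)
    qed
    then have lim: "(\<lambda>m. prob (A r m)) \<longlonglongrightarrow> prob (\<Union>m. A r m)"
      using A by (intro finite_Lim_measure_incseq) auto
    have "prob (A r m) \<le> K ^ k * real r powr (- (real k * (q - 1)))" if m: "m \<ge> r" for m
    proof -
      have "prob (A r m) \<le> prob (grown c q r k m)"
        unfolding A_def by (intro finite_measure_mono grown_sets) auto
      also have "\<dots> \<le> (K * real r powr (1 - q)) ^ k"
        using prob_grown_le[OF c q r order_refl m] by (simp add: K_def)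
      also have "\<dots> = K ^ k * real r powr (- (real k * (q - 1)))"
        using r by (simp add: power_mult_distrib powr_realpow[symmetric] powr_powr)
          (simp add: algebra_simps)
      finally show ?thesis .
    qed
    then show ?thesis by (intro LIMSEQ_le_const2[OF lim]) blast
  qed
  have "summable (\<lambda>r. K ^ k * real r powr (- (real k * (q - 1))))"
    using k by (intro summable_mult) (simp add: summable_real_powr_iff)
  then have "summable (\<lambda>r. prob (\<Union>m. A r m))"
    by (rule summable_comparison_test'[where N = 1]) (use bound in auto)
  then have "AE \<omega> in M. eventually (\<lambda>r. \<omega> \<in> space M - (\<Union>m. A r m)) sequentially"
    using A by (intro borel_cantelli_AE1) (auto simp: emeasure_eq_measure)
  then show ?thesis
  proof eventually_elim
    case (elim \<omega>)
    show ?case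
    proof
      assume "\<forall>m. c * (real m + 1) powr q \<le> Z (parents \<omega>) m"
      moreover obtain N where "\<And>r. r \<ge> N \<Longrightarrow> \<omega> \<in> space M - (\<Union>m. A r m)"
        using elim unfolding eventually_sequentially by blast
      ultimately have "{r. \<exists>m. k \<le> card (descs (parents \<omega>) m r)} \<subseteq> {..<N}"
        using A_iff by (fastforce simp: not_less[symmetric])
      then show "finite {r. \<exists>m. k \<le> card (descs (parents \<omega>) m r)}"
        by (rule finite_subset) simp
    qed
  qed
qed

text \<open>The constant may depend on \<open>\<omega>\<close>, but each \<open>c > 0\<close> can be
  lowered to some \<open>inverse (real (Suc n))\<close>, so countably many null sets are
  enough.\<close>

lemma AE_ex_pos:
  assumes "\<And>c. c > 0 \<Longrightarrow> AE \<omega> in M. (\<forall>m. c * (real m + 1) powr q \<le> Z (parents \<omega>) m) \<longrightarrow> P \<omega>"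
  shows "AE \<omega> in M. (\<exists>c>0. \<forall>m. c * (real m + 1) powr q \<le> Z (parents \<omega>) m) \<longrightarrow> P \<omega>"
proof -
  have "AE \<omega> in M. \<forall>n. (\<forall>m. inverse (real (Suc n)) * (real m + 1) powr q \<le> Z (parents \<omega>) m) \<longrightarrow> P \<omega>"
    unfolding AE_all_countable by (intro allI assms) simp
  then show ?thesis
  proof eventually_elim
    case (elim \<omega>)
    show ?case
    proof (intro impI, elim exE conjE)
      fix c :: real assume c: "c > 0" and *: "\<forall>m. c * (real m + 1) powr q \<le> Z (parents \<omega>) m"
      obtain n where n: "inverse (real (Suc n)) < c" using reals_Archimedean[OF c] by blast
      have "inverse (real (Suc n)) * (real m + 1) powr q \<le> Z (parents \<omega>) m" for m
        using mult_right_mono[OF less_imp_le[OF n], of "(real m + 1) powr q"] * by (meson order_trans powr_ge_zero)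
      then show "P \<omega>" using elim by blast
    qed
  qed
qed

lemma AE_finite_large:
  assumes "q > 1" "real k * (q - 1) > 1"
  shows "AE \<omega> in M. (\<exists>c>0. \<forall>m. c * (real m + 1) powr q \<le> Z (parents \<omega>) m) \<longrightarrow>
           finite {r. \<exists>m. k \<le> card (descs (parents \<omega>) m r)}"
  by (intro AE_ex_pos AE_finite_large_if_fast assms)

end

section \<open>Linear growth of the maximal degree\<close>

lemma indeg_conv_lessThan: "indeg h m v = card {j \<in> {..<m}. h (Suc j) = v}"
proof -
  have "{j \<in> {1..m}. h j = v} = Suc ` {j \<in> {..<m}. h (Suc j) = v}"
  proof (intro equalityI subsetI)
    fix j assume "j \<in> {j \<in> {1..m}. h j = v}"
    then show "j \<in> Suc ` {j \<in> {..<m}. h (Suc j) = v}" by (cases j) auto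
  qed auto
  then show ?thesis by (simp add: indeg_def card_image)
qed

text \<open>Edges are sorted by the degree of the parent on arrival. Up to a constant at most
  \<open>m / 2\<close> of the first \<open>m\<close> go to parents of degree below \<open>K\<close>;
  the others all go to a finite set of nodes, one of which must then have linear degree.\<close>

lemma maxdeg_linear:
  fixes h :: "nat \<Rightarrow> nat" and K :: nat
  assumes h: "parent_map h"
    and sm: "summable (\<lambda>j. of_bool (indeg h j (h (Suc j)) < K) / (real j + 1) :: real)"
    and fin: "finite {r. \<exists>m. K \<le> card (descs h m r)}"
  shows "\<exists>c>0. \<forall>m. c * (real m + 1) \<le> real (maxdeg h m) + 1"
proof -
  define low where "low j \<longleftrightarrow> indeg h j (h (Suc j)) < K" for j
  define S where "S = {r. \<exists>m. K \<le> card (descs h m r)}"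
  \<comment> \<open>A tail below \<open>1 / 2\<close> leaves room for at most \<open>m / 2\<close>
    low edges between \<open>N\<close> and \<open>m\<close>.\<close>
  obtain N where N: "\<And>m n. m \<ge> N \<Longrightarrow> norm (\<Sum>j\<in>{m..<n}. of_bool (low j) / (real j + 1) :: real) < 1 / 2"
  proof -
    have "\<exists>N. \<forall>m\<ge>N. \<forall>n. norm (\<Sum>j\<in>{m..<n}. of_bool (low j) / (real j + 1) :: real) < 1 / 2"
      using sm[folded low_def] unfolding summable_Cauchy by (elim allE[of _ "1 / 2"]) simp
    then show ?thesis using that by blast
  qed
  have low_le: "2 * card {j \<in> {..<m}. low j} \<le> 2 * N + m" for m
  proof -
    have "{j \<in> {..<m}. low j} \<subseteq> {..<N} \<union> {j \<in> {N..<m}. low j}" by auto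
    then have "card {j \<in> {..<m}. low j} \<le> card ({..<N} \<union> {j \<in> {N..<m}. low j})"
      by (intro card_mono) auto
    also have "\<dots> \<le> N + card {j \<in> {N..<m}. low j}"
      using card_Un_le[of "{..<N}" "{j \<in> {N..<m}. low j}"] by simp
    finally have 1: "card {j \<in> {..<m}. low j} \<le> N + card {j \<in> {N..<m}. low j}" .
    have "real (card {j \<in> {N..<m}. low j}) = (\<Sum>j\<in>{N..<m}. of_bool (low j))"
      by (simp add: sum_of_bool_eq Int_def)
    \<comment> \<open>For \<open>j < m\<close> a low edge contributes at least \<open>1 / m\<close>
      to the tail.\<close>
    also have "\<dots> \<le> (\<Sum>j\<in>{N..<m}. real m * (of_bool (low j) / (real j + 1)))"
      by (rule sum_mono) (auto simp: field_simps)
    also have "\<dots> = real m * (\<Sum>j\<in>{N..<m}. of_bool (low j) / (real j + 1))"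
      by (simp add: sum_distrib_left)
    also have "\<dots> \<le> real m * (1 / 2)"
      using N[of N m] by (intro mult_left_mono) auto
    finally have "2 * card {j \<in> {N..<m}. low j} \<le> m" by linarith
    with 1 show ?thesis by linarith
  qed
  have high_le: "card {j \<in> {..<m}. \<not> low j} \<le> card S * maxdeg h m" for m
  proof -
    \<comment> \<open>A parent with at least \<open>K\<close> children has at least \<open>K\<close>
      descendants and so belongs to \<open>S\<close>.\<close>
    have "{j \<in> {..<m}. \<not> low j} \<subseteq> (\<Union>v\<in>S. {j \<in> {..<m}. h (Suc j) = v})"
    proof
      fix j assume "j \<in> {j \<in> {..<m}. \<not> low j}"
      then have j: "j < m" "K \<le> indeg h j (h (Suc j))" by (auto simp: low_def)
      have "indeg h j (h (Suc j)) \<le> card (descs h j (h (Suc j)))"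
        by (rule indeg_le_card_descs) simp
      with j have "K \<le> card (descs h j (h (Suc j)))" by linarith
      then have "h (Suc j) \<in> S" unfolding S_def by blast
      with j show "j \<in> (\<Union>v\<in>S. {j \<in> {..<m}. h (Suc j) = v})" by auto
    qed
    then have "card {j \<in> {..<m}. \<not> low j} \<le> card (\<Union>v\<in>S. {j \<in> {..<m}. h (Suc j) = v})"
      using fin by (intro card_mono) (auto simp: S_def)
    also have "\<dots> \<le> (\<Sum>v\<in>S. card {j \<in> {..<m}. h (Suc j) = v})"
      using fin by (intro card_UN_le) (simp add: S_def)
    also have "\<dots> \<le> (\<Sum>v\<in>S. maxdeg h m)"
    proof (rule sum_mono)
      fix v
      show "card {j \<in> {..<m}. h (Suc j) = v} \<le> maxdeg h m"
      proof (cases "v \<le> m")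
        case True
        then show ?thesis using indeg_le_maxdeg[of v m h] by (simp add: indeg_conv_lessThan)
      next
        case False
        have "h (Suc j) \<noteq> v" if "j < m" for j
        proof -
          have "h (Suc j) < Suc j" using h by (auto simp: parent_map_def)
          then show ?thesis using False that by linarith
        qed
        then have "{j \<in> {..<m}. h (Suc j) = v} = {}" by blast
        then show ?thesis by (simp only: card.empty zero_le)
      qed
    qed
    finally show ?thesis by simp
  qed
  \<comment> \<open>The two counts give \<open>m \<le> 2 * N + 2 * card S * maxdeg h m\<close>; the
    final 1 matches the shift to \<open>m + 1\<close> and keeps the denominator positive.\<close>
  define c where "c = 1 / (2 * real N + 2 * real (card S) + 1)"
  have "c * (real m + 1) \<le> real (maxdeg h m) + 1" for m
  proof -
    have "{..<m} = {j \<in> {..<m}. low j} \<union> {j \<in> {..<m}. \<not> low j}" by auto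
    then have "m = card ({j \<in> {..<m}. low j} \<union> {j \<in> {..<m}. \<not> low j})"
      by (metis card_lessThan)
    also have "\<dots> = card {j \<in> {..<m}. low j} + card {j \<in> {..<m}. \<not> low j}"
      by (rule card_Un_disjoint) auto
    finally have "m \<le> 2 * N + 2 * (card S * maxdeg h m)"
      using low_le[of m] high_le[of m] by linarith
    then have "real m \<le> 2 * real N + 2 * (real (card S) * real (maxdeg h m))"
      by (metis (mono_tags) of_nat_add of_nat_le_iff of_nat_mult of_nat_numeral)
    moreover have "(2 * real N + 2 * real (card S) + 1) * (real (maxdeg h m) + 1) =
        2 * real N + 2 * (real (card S) * real (maxdeg h m)) + 1 +
        (2 * real N * real (maxdeg h m) + 2 * real (card S) + real (maxdeg h m))"
      by (simp add: algebra_simps)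
    moreover have "0 \<le> 2 * real N * real (maxdeg h m) + 2 * real (card S) + real (maxdeg h m)"
      by simp
    ultimately have "real m + 1 \<le> (2 * real N + 2 * real (card S) + 1) * (real (maxdeg h m) + 1)"
      by linarith
    then show ?thesis
      unfolding c_def by (subst times_divide_eq_left, subst pos_divide_le_eq) (auto simp: mult.commute)
  qed
  moreover have "c > 0" by (simp add: c_def add_nonneg_pos)
  ultimately show ?thesis by blast
qed

section \<open>Almost sure growth of the total weight with exponent \<open>p\<close>\<close>

context superlinear_GN
begin

text \<open>At time \<open>j\<close> the nodes of degree below \<open>K\<close> have total weight at
  most \<open>(j + 1) * K powr p\<close>. Under the growth bound they attract the next edge with
  probability at most \<open>C * (j + 1) powr (1 - q)\<close>, and division by \<open>j + 1\<close>
  makes this summable.\<close>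

lemma AE_summable_low:
  assumes c: "c > 0" and q: "q > 1"
  shows "AE \<omega> in M. (\<forall>m. c * (real m + 1) powr q \<le> Z (parents \<omega>) m) \<longrightarrow>
           summable (\<lambda>j. of_bool (indeg (parents \<omega>) j (w (Suc j) \<omega>) < K) / (real j + 1) :: real)"
proof -
  \<comment> \<open>Only the bound at time \<open>j\<close> enters the \<open>j\<close>-th term, so
    that it is decided by the past.\<close>
  let ?A = "\<lambda>j h. c * (real j + 1) powr q \<le> Z h j"
  let ?S = "\<lambda>j h. {x. indeg h j x < K}"
  let ?g = "\<lambda>j h. of_bool (?A j h \<and> h (Suc j) \<in> ?S j h) / (real j + 1) :: real"
  define C where "C = real K powr p / c"
  have C: "C \<ge> 0" using c by (simp add: C_def)
  have A: "depends_upto j (?A j)" for j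
    by (rule depends_upto_compose[OF depends_upto_weight])
  have S: "depends_upto j (?S j)" for j
    by (rule depends_upto_compose[OF depends_upto_indeg, where g = "\<lambda>d. {x. d x < K}"])
  have AS: "depends_upto (Suc j) (\<lambda>h. ?A j h \<and> h (Suc j) \<in> ?S j h)" for j
    by (rule depends_upto_compose2[where g = "(\<and>)"], rule depends_upto_mono[OF A], simp,
        rule depends_upto_compose2[where g = "(\<in>)"], simp add: depends_upto_def,
        rule depends_upto_mono[OF S], simp)
  have int: "integrable M (\<lambda>\<omega>. ?g j (parents \<omega>))" for j
    by (rule depends_upto_integrable[where \<phi> = "?g j"],
        rule depends_upto_compose[OF AS, where g = "\<lambda>b. of_bool b / (real j + 1)"])
  have E: "expectation (\<lambda>\<omega>. ?g j (parents \<omega>)) \<le> C * (real (Suc j)) powr (- q)" for j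
  proof -
    let ?B = "{\<omega> \<in> space M. ?A j (parents \<omega>) \<and> w (Suc j) \<omega> \<in> ?S j (parents \<omega>)}"
    let ?a = "C * (real j + 1) * (real j + 1) powr (- q)"
    have "expectation (\<lambda>\<omega>. ?g j (parents \<omega>)) = expectation (\<lambda>\<omega>. indicator ?B \<omega> / (real j + 1))"
      by (intro Bochner_Integration.integral_cong) (auto simp: indicator_def)
    also have "\<dots> = prob ?B / (real j + 1)"
    proof -
      have "?B \<inter> space M = ?B" by blast
      then show ?thesis
        by (simp only: Bochner_Integration.integral_divide_zero Bochner_Integration.integral_indicator)
    qed
    also have "prob ?B \<le> ?a * prob {\<omega> \<in> space M. ?A j (parents \<omega>)}"
    proof (rule prob_step_le[OF A S])
      fix h assume h: "?A j h"
      have "(\<Sum>x\<in>?S j h \<inter> {..j}. (real (indeg h j x) + 1) powr p) \<le> (\<Sum>x\<in>?S j h \<inter> {..j}. real K powr p)"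
        using p_gt_1 by (intro sum_mono powr_mono2) auto
      also have "\<dots> \<le> (real j + 1) * real K powr p"
      proof -
        have "card (?S j h \<inter> {..j}) \<le> card {..j}" by (intro card_mono) auto
        then have "real (card (?S j h \<inter> {..j})) \<le> real j + 1" by simp
        then show ?thesis by (simp add: mult_right_mono)
      qed
      also have "\<dots> = ?a * (c * (real j + 1) powr q)"
        using c by (simp add: C_def powr_minus field_simps)
      also have "\<dots> \<le> ?a * Z h j"
        using h C by (intro mult_left_mono) auto
      finally show "(\<Sum>x\<in>?S j h \<inter> {..j}. (real (indeg h j x) + 1) powr p) \<le> ?a * Z h j" .
    qed
    also have "?a * prob {\<omega> \<in> space M. ?A j (parents \<omega>)} \<le> ?a * 1"
      using C by (intro mult_left_mono prob_le_1) auto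
    also have "?a * 1 / (real j + 1) = C * (real j + 1) powr (- q)"
      by simp
    finally show ?thesis by (simp add: divide_right_mono add.commute)
  qed
  have "summable (\<lambda>j. real j powr (- q))"
    using q by (simp add: summable_real_powr_iff)
  then have sm: "summable (\<lambda>j. C * real (Suc j) powr (- q))"
    by (intro summable_mult) (subst summable_Suc_iff)
  have "(\<Sum>j<n. expectation (\<lambda>\<omega>. ?g j (parents \<omega>))) \<le> (\<Sum>j. C * real (Suc j) powr (- q))" for n
  proof -
    have "(\<Sum>j<n. expectation (\<lambda>\<omega>. ?g j (parents \<omega>))) \<le> (\<Sum>j<n. C * real (Suc j) powr (- q))"
      by (intro sum_mono E)
    also have "\<dots> \<le> (\<Sum>j. C * real (Suc j) powr (- q))"
      using C by (intro sum_le_suminf sm) auto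
    finally show ?thesis .
  qed
  then have "AE \<omega> in M. summable (\<lambda>j. ?g j (parents \<omega>))"
    by (intro AE_summable_of_bounded_expectation int) auto
  \<comment> \<open>If the bound holds at all times, the first conjunct inside \<open>?g\<close> is
    always true.\<close>
  then show ?thesis
    by eventually_elim (auto cong: if_cong)
qed

text \<open>A bootstrap: the first exponent \<open>q > 1\<close> leaves finitely many nodes with
  \<open>K\<close> descendants, which forces a maximal degree of linear order, and the weight of
  that single node already has order \<open>m powr p\<close>.\<close>

lemma AE_full_growth:
  "AE \<omega> in M. \<exists>c>0. \<forall>m. c * (real m + 1) powr p \<le> Z (parents \<omega>) m"
proof -
  obtain q where q: "q > 1"
    and growth: "AE \<omega> in M. \<exists>c>0. \<forall>m. c * (real m + 1) powr q \<le> Z (parents \<omega>) m"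
    using initial_growth by blast
  \<comment> \<open>\<open>K\<close> is chosen so large that \<open>K * (q - 1) > 1\<close>, however
    close \<open>q\<close> is to 1.\<close>
  obtain K :: nat where "real K > 1 / (q - 1)" using reals_Archimedean2 by blast
  then have K: "real K * (q - 1) > 1" using q by (simp add: field_simps)
  have "AE \<omega> in M. (\<exists>c>0. \<forall>m. c * (real m + 1) powr q \<le> Z (parents \<omega>) m) \<longrightarrow>
      summable (\<lambda>j. of_bool (indeg (parents \<omega>) j (w (Suc j) \<omega>) < K) / (real j + 1) :: real)"
    using q by (intro AE_ex_pos AE_summable_low)
  with AE_finite_large[OF q K] growth AE_space show ?thesis
  proof eventually_elim
    case (elim \<omega>)
    from maxdeg_linear[OF parent_map_parents[OF elim(3)] mp[OF elim(4) elim(2)] mp[OF elim(1) elim(2)]]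
    obtain c where c: "c > 0" "\<And>m. c * (real m + 1) \<le> real (maxdeg (parents \<omega>) m) + 1"
      by blast
    have "c powr p * (real m + 1) powr p \<le> Z (parents \<omega>) m" for m
    proof -
      have "c powr p * (real m + 1) powr p = (c * (real m + 1)) powr p"
        using c(1) by (subst powr_mult) auto
      also have "\<dots> \<le> (real (maxdeg (parents \<omega>) m) + 1) powr p"
        using c p_gt_1 by (intro powr_mono2) auto
      also have "\<dots> \<le> Z (parents \<omega>) m" by (rule maxdeg_le_weight)
      finally show ?thesis .
    qed
    then show ?case using c(1) by (intro exI[of _ "c powr p"]) auto
  qed
qed

section \<open>Passage to the limit tree\<close>

lemma descendants_limit_tree:
  assumes "\<omega> \<in> space M"
  shows "descendants (limit_tree (\<lambda>m. T m \<omega>)) r = desc (parents \<omega>) r"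
proof -
  have "parcs (limit_tree (\<lambda>m. T m \<omega>)) = {(j, w j \<omega>) |j. 1 \<le> j}"
  proof -
    have "parcs (limit_tree (\<lambda>m. T m \<omega>)) = (\<lambda>j. (j, w j \<omega>)) ` (\<Union>m. {1..m})"
      using assms by (simp add: limit_tree_def T_eq_tree_of tree_of_def image_UN)
    also have "(\<Union>m. {1..m}) = {j::nat. 1 \<le> j}" by auto
    finally show ?thesis by (simp only: setcompr_eq_image)
  qed
  then show ?thesis by (simp add: descendants_def desc_def)
qed

end

text \<open>Any \<open>k\<close> descendants form a finite set of numbers and are all present by
  some finite time; this includes nodes with infinitely many descendants.\<close>

lemma ex_large_descs:
  assumes "\<not> (finite (desc h r) \<and> card (desc h r) < k)"
  shows "\<exists>m. k \<le> card (descs h m r)"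
proof -
  obtain B where B: "B \<subseteq> desc h r" "finite B" "card B = k"
  proof (cases "finite (desc h r)")
    case True
    then have "k \<le> card (desc h r)" using assms by simp
    then show ?thesis using obtain_subset_with_card_n that by metis
  next
    case False
    then show ?thesis using infinite_arbitrarily_large that by metis
  qed
  obtain m where "B \<subseteq> {..m}" using B(2) finite_nat_iff_bounded_le by blast
  then have "card B \<le> card (descs h m r)"
    using B(1) by (intro card_mono) (auto simp: descs_def)
  then show ?thesis using B(3) by blast
qed

theorem theorem1p1:
  fixes k :: nat and p :: real
    and M :: "'a measure"
    and w :: "nat \<Rightarrow> 'a \<Rightarrow> nat"
    and T :: "nat \<Rightarrow> 'a \<Rightarrow> nat pair_pre_digraph"
  assumes "k \<ge> 1"
    and "p > 1 + 1 / real k"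
    and "GN_process M (\<lambda>x. (real x + 1) powr p) w T"
  shows "AE \<omega> in M. let U = limit_tree (\<lambda>m. T m \<omega>) in
           finite {r \<in> pverts U. \<not> (finite (descendants U r) \<and> card (descendants U r) < k)}"
proof -
  have "1 / real k > 0" using assms(1) by simp
  then have p: "p > 1" using assms(2) by linarith
  interpret superlinear_GN M p w T
    by (intro superlinear_GN.intro superlinear_GN_axioms.intro assms(3) p)
  \<comment> \<open>The threshold \<open>1 + 1 / k\<close> is exactly the summability condition for
    exponent \<open>p\<close>.\<close>
  have "real k * (p - 1) > 1" using assms(1,2) by (simp add: field_simps)
  from AE_finite_large[OF p this] AE_full_growth AE_space show ?thesis
  proof eventually_elim
    case (elim \<omega>)
    then have "finite {r. \<exists>m. k \<le> card (descs (parents \<omega>) m r)}" by blast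
    moreover have "{r. \<not> (finite (desc (parents \<omega>) r) \<and> card (desc (parents \<omega>) r) < k)}
        \<subseteq> {r. \<exists>m. k \<le> card (descs (parents \<omega>) m r)}"
      using ex_large_descs[of "parents \<omega>" _ k] by blast
    ultimately have "finite {r. \<not> (finite (desc (parents \<omega>) r) \<and> card (desc (parents \<omega>) r) < k)}"
      by (rule finite_subset[rotated])
    then show ?case
      unfolding Let_def descendants_limit_tree[OF elim(3)] by (rule rev_finite_subset) blast
  qed
qed

end
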